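(* The space $\mathscr G=\left\{\sum_{n=0}^\infty f_n\xi_n:\ \sum_{n\in\mathbb N_0}|f_n|^22^{np}<\infty\text{ for all }p\in\mathbb N\right\}$ is the space of all entire functions $f(z)$, $z=x+iy$, such that $$\iint_{\mathbb C}|f(z)|^2\,e^{\frac{1-2^{-p}}{1+2^{-p}}x^2-\frac{1+2^{-p}}{1-2^{-p}}y^2}\,dx\,dy<\infty\qquad\text{for all }p\in\mathbb N.$$
   Context: $\mathbb N=\{1,2,\dots\}$, $\mathbb N_0=\mathbb N\cup\{0\}$; the $f_n$ are complex numbers. Hermite functions: $\xi_n(x)=\pi^{-1/4}(2^nn!)^{-1/2}e^{-x^2/2}h_n(x)$ with $h_n(x)=(-1)^ne^{x^2}\frac{d^n}{dx^n}(e^{-x^2})$, $n\in\mathbb N_0$; they form an orthonormal basis of $\mathbf L_2(\mathbb R,dx)$ and extend to entire functions $\xi_n(z)$. $\mathscr G$ is a subspace of the Schwartz space on $\mathbb R$; its elements are identified with their extensions to entire functions on $\mathbb C$ (given by the series $\sum_nf_n\xi_n(z)$). *)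

theory Defs
  imports "HOL-Complex_Analysis.Complex_Analysis"
begin

text \<open>
  The definition is polymorphic: at type \<^typ>\<open>real\<close> it is Rodrigues' formula on the line, at type
  \<^typ>\<open>complex\<close> it is the entire extension (see \<open>hermite_h_of_real\<close> below).
\<close>

definition hermite_h :: "nat \<Rightarrow> 'a \<Rightarrow> 'a::{real_normed_field,banach}" where
  "hermite_h n x = (-1) ^ n * exp (x\<^sup>2) * (deriv ^^ n) (\<lambda>t. exp (- t\<^sup>2)) x"

definition hermite_xi :: "nat \<Rightarrow> complex \<Rightarrow> complex" where
  "hermite_xi n z = of_real (pi powr (-1/4) * (2 ^ n * fact n) powr (-1/2)) * exp (- z\<^sup>2 / 2) * hermite_h n z"

definition rapid_coeffs :: "(nat \<Rightarrow> complex) set" where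
  "rapid_coeffs = {f. \<forall>p::nat. p \<ge> 1 \<longrightarrow> summable (\<lambda>n. (cmod (f n))\<^sup>2 * 2 ^ (n * p))}"

text \<open>
  Elements are represented by their entire extensions. The series converges absolutely at every
  point for every admissible coefficient sequence, so \<^const>\<open>suminf\<close> is never applied to a
  divergent series: see \<open>summable_hermite_series\<close> below.
\<close>

definition space_G :: "(complex \<Rightarrow> complex) set" where
  "space_G = {(\<lambda>z. \<Sum>n. f n * hermite_xi n z) |f. f \<in> rapid_coeffs}"


subsection \<open>Well-definedness\<close>

fun hermite_rec :: "nat \<Rightarrow> 'a \<Rightarrow> 'a::{real_normed_field,banach}" where
  "hermite_rec 0 x = 1"
| "hermite_rec (Suc 0) x = 2 * x"
| "hermite_rec (Suc (Suc n)) x = 2 * x * hermite_rec (Suc n) x - 2 * of_nat (Suc n) * hermite_rec n x"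

lemma hermite_rec_deriv:
  "(hermite_rec (Suc n) has_field_derivative (2 * of_nat (Suc n) * hermite_rec n x)) (at x)"
proof (induction n arbitrary: x rule: induct_nat_012)
  case 0
  have "hermite_rec (Suc 0) = (\<lambda>x::'a. 2 * x)" by (rule ext) simp
  then show ?case by (auto intro!: derivative_eq_intros)
next
  case 1
  have "hermite_rec (Suc (Suc 0)) = (\<lambda>x::'a. 2 * x * (2 * x) - 2)" by (rule ext) simp
  then show ?case by (auto intro!: derivative_eq_intros)
next
  case (ge2 n x)
  have e: "hermite_rec (Suc (Suc (Suc n))) =
     (\<lambda>x::'a. 2 * x * hermite_rec (Suc (Suc n)) x - 2 * of_nat (Suc (Suc n)) * hermite_rec (Suc n) x)"
    by (rule ext) simp
  show ?case unfolding e
    by (rule derivative_eq_intros ge2 refl)+ (simp add: algebra_simps)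
qed

lemma deriv_gauss:
  "(deriv ^^ n) (\<lambda>t. exp (- t\<^sup>2)) = (\<lambda>x::'a::{real_normed_field,banach}. (-1) ^ n * hermite_rec n x * exp (- x\<^sup>2))"
proof (induction n)
  case 0
  show ?case by simp
next
  case (Suc n)
  have d: "((\<lambda>x. (-1) ^ n * hermite_rec n x * exp (- x\<^sup>2)) has_field_derivative
         (-1) ^ Suc n * hermite_rec (Suc n) x * exp (- x\<^sup>2)) (at x)" for x :: 'a
  proof (cases n)
    case 0
    then show ?thesis by (auto intro!: derivative_eq_intros)
  next
    case (Suc m)
    show ?thesis unfolding Suc
      by (rule derivative_eq_intros hermite_rec_deriv refl)+ (simp add: algebra_simps)
  qed
  show ?case by (simp only: funpow.simps o_apply Suc) (rule ext, rule DERIV_imp_deriv, rule d)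
qed

lemma hermite_h_eq_rec: "hermite_h n x = hermite_rec n x"
proof -
  have "hermite_h n x = ((-1) ^ n * (-1) ^ n) * (exp (x\<^sup>2) * exp (- x\<^sup>2)) * hermite_rec n x"
    by (simp add: hermite_h_def deriv_gauss mult_ac)
  also have "\<dots> = hermite_rec n x"
    by (simp add: exp_minus flip: power_mult_distrib)
  finally show ?thesis .
qed

lemma hermite_h_of_real: "hermite_h n (complex_of_real x) = of_real (hermite_h n x)"
proof -
  have "hermite_rec n (complex_of_real x) = of_real (hermite_rec n x)"
    by (induction n x rule: hermite_rec.induct) auto
  then show ?thesis by (simp add: hermite_h_eq_rec)
qed

lemma norm_hermite_rec_le:
  "cmod (hermite_rec n z) \<le> sqrt (2 ^ n * fact n) * (1 + 2 * cmod z) ^ n"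
proof (induction n z rule: hermite_rec.induct)
  case (1 z)
  show ?case by simp
next
  case (2 z)
  have "2 * cmod z \<le> sqrt 2 * (1 + 2 * cmod z)"
    using mult_mono[of 1 "sqrt 2" "2 * cmod z" "1 + 2 * cmod z"] by simp
  then show ?case by (simp add: norm_mult)
next
  case (3 n z)
  define B where "B = 1 + 2 * cmod z"
  define s where "s = sqrt (2 ^ n * fact n)"
  define k where "k = real (Suc n)"
  define l where "l = real (Suc (Suc n))"
  have kl: "k \<ge> 1" "l \<ge> 2" "k \<le> l" by (auto simp: k_def l_def)
  have s0: "s \<ge> 0" and B1: "B \<ge> 1" by (auto simp: s_def B_def)
  have s1: "sqrt (2 ^ Suc n * fact (Suc n)) = sqrt (2 * k) * s"
    unfolding s_def k_def by (simp flip: real_sqrt_mult add: algebra_simps)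
  have s2: "sqrt (2 ^ Suc (Suc n) * fact (Suc (Suc n))) = sqrt (2 * l) * sqrt (2 * k) * s"
    unfolding s_def k_def l_def by (simp flip: real_sqrt_mult add: algebra_simps)
  have l2: "sqrt (2 * l) \<ge> 2" using kl by (intro real_le_rsqrt) simp
  have kk: "2 * k = sqrt (2 * k) * sqrt (2 * k)" using kl by simp
  have kl2: "2 * k \<le> sqrt (2 * l) * sqrt (2 * k)"
    by (subst kk, rule mult_right_mono) (use kl in auto)
  have a: "2 * cmod z * cmod (hermite_rec (Suc n) z) \<le>
       2 * cmod z * (sqrt (2 * k) * s * B ^ Suc n)"
    using "3.IH"(1) unfolding s1 B_def[symmetric] by (intro mult_left_mono) auto
  have "2 * cmod z * (sqrt (2 * k) * s * B ^ Suc n) \<le>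
       2 * cmod z * (sqrt (2 * l) * sqrt (2 * k) * s * B ^ Suc n)"
  proof (intro mult_left_mono mult_right_mono)
    show "sqrt (2 * k) \<le> sqrt (2 * l) * sqrt (2 * k)"
      using l2 kl mult_right_mono[of 1 "sqrt (2 * l)" "sqrt (2 * k)"] by simp
  qed (use s0 B1 in auto)
  with a have a': "2 * cmod z * cmod (hermite_rec (Suc n) z) \<le>
       2 * cmod z * (sqrt (2 * l) * sqrt (2 * k) * s * B ^ Suc n)" by linarith
  have "2 * k * cmod (hermite_rec n z) \<le> (sqrt (2 * l) * sqrt (2 * k)) * (s * B ^ n)"
    by (rule mult_mono) (use "3.IH"(2) kl2 kl in \<open>auto simp: s_def B_def\<close>)
  also have "\<dots> \<le> (sqrt (2 * l) * sqrt (2 * k)) * (s * B ^ Suc n)"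
    using s0 B1 kl by (intro mult_left_mono power_increasing) auto
  finally have b: "2 * k * cmod (hermite_rec n z) \<le> sqrt (2 * l) * sqrt (2 * k) * s * B ^ Suc n"
    by (simp add: mult_ac)
  have "cmod (hermite_rec (Suc (Suc n)) z) \<le>
      cmod (2 * z * hermite_rec (Suc n) z) + cmod (2 * of_nat (Suc n) * hermite_rec n z)"
    unfolding hermite_rec.simps by (rule norm_triangle_ineq4)
  also have "\<dots> = 2 * cmod z * cmod (hermite_rec (Suc n) z) + 2 * k * cmod (hermite_rec n z)"
    unfolding k_def norm_mult norm_of_nat by simp
  also have "\<dots> \<le> sqrt (2 * l) * sqrt (2 * k) * s * B ^ Suc n * B"
    using a' b by (simp add: B_def algebra_simps)
  finally show ?case unfolding s2 B_def[symmetric] by (simp add: mult_ac)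
qed

lemma norm_hermite_xi_le:
  "cmod (hermite_xi n z) \<le> pi powr (-1/4) * cmod (exp (- z\<^sup>2 / 2)) * (1 + 2 * cmod z) ^ n"
proof -
  let ?q = "2 ^ n * fact n :: real"
  have q: "?q > 0" by simp
  have qs: "?q powr (-1/2) * sqrt ?q = 1"
    using q by (simp add: powr_minus powr_half_sqrt[symmetric] field_simps flip: powr_add)
  have "cmod (hermite_xi n z) =
     pi powr (-1/4) * ?q powr (-1/2) * cmod (exp (- z\<^sup>2 / 2)) * cmod (hermite_rec n z)"
    by (simp add: hermite_xi_def hermite_h_eq_rec norm_mult del: norm_exp_eq_Re)
  also have "\<dots> \<le> pi powr (-1/4) * ?q powr (-1/2) * cmod (exp (- z\<^sup>2 / 2)) *
      (sqrt ?q * (1 + 2 * cmod z) ^ n)"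
    by (intro mult_left_mono norm_hermite_rec_le) auto
  also have "\<dots> = pi powr (-1/4) * cmod (exp (- z\<^sup>2 / 2)) * (1 + 2 * cmod z) ^ n *
      (?q powr (-1/2) * sqrt ?q)"
    by (simp only: mult_ac)
  finally show ?thesis unfolding qs by simp
qed

lemma summable_hermite_series:
  assumes "f \<in> rapid_coeffs"
  shows "summable (\<lambda>n. norm (f n * hermite_xi n z))"
proof -
  define B where "B = 1 + 2 * cmod z"
  define K where "K = pi powr (-1/4) * cmod (exp (- z\<^sup>2 / 2))"
  have B1: "B \<ge> 1" and K0: "K \<ge> 0" by (auto simp: B_def K_def)
  obtain p0 :: nat where p0: "4 * B\<^sup>2 < 2 ^ p0" using real_arch_pow[of 2 "4 * B\<^sup>2"] by auto
  define p where "p = Suc p0"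
  have "(2::real) ^ p0 \<le> 2 ^ p" by (simp add: p_def)
  then have p: "4 * B\<^sup>2 \<le> 2 ^ p" "p \<ge> 1" using p0 by (linarith, simp add: p_def)
  have S: "summable (\<lambda>n. (cmod (f n))\<^sup>2 * 2 ^ (n * p))"
    using assms p(2) by (auto simp: rapid_coeffs_def)
  have "summable (\<lambda>n. K * ((cmod (f n))\<^sup>2 * 2 ^ (n * p) + (1/4) ^ n))"
    by (intro summable_mult summable_add S summable_geometric) auto
  then show ?thesis
  proof (rule summable_comparison_test[OF exI[of _ 0], rotated], intro allI impI)
    fix n
    define u where "u = cmod (f n)"
    have "u * B ^ n = (u * (2 * B) ^ n) * (1/2) ^ n"
      by (simp add: power_mult_distrib power_one_over)
    also have "\<dots> \<le> (u * (2 * B) ^ n)\<^sup>2 + ((1/2) ^ n)\<^sup>2"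
    proof -
      have "a * b \<le> a\<^sup>2 + b\<^sup>2" for a b :: real
        using sum_squares_bound[of a b] zero_le_power2[of a] zero_le_power2[of b] by linarith
      then show ?thesis .
    qed
    also have "\<dots> = u\<^sup>2 * (4 * B\<^sup>2) ^ n + (1/4) ^ n"
    proof -
      have "((2 * B) ^ n)\<^sup>2 = (4 * B\<^sup>2) ^ n"
        by (subst power_mult[symmetric], subst mult.commute, subst power_mult) (simp add: power_mult_distrib)
      moreover have "((1/2::real) ^ n)\<^sup>2 = (1/4) ^ n"
        by (subst power_mult[symmetric], subst mult.commute, subst power_mult) (simp add: power_divide)
      ultimately show ?thesis by (simp add: power_mult_distrib[of u])
    qed
    also have "u\<^sup>2 * (4 * B\<^sup>2) ^ n \<le> u\<^sup>2 * 2 ^ (n * p)"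
    proof -
      have "(4 * B\<^sup>2) ^ n \<le> (2 ^ p) ^ n" using p by (intro power_mono) auto
      also have "(2 ^ p) ^ n = (2::real) ^ (n * p)" by (simp add: mult.commute flip: power_mult)
      finally show ?thesis by (intro mult_left_mono) auto
    qed
    finally have *: "u * B ^ n \<le> u\<^sup>2 * 2 ^ (n * p) + (1/4) ^ n" by simp
    have "norm (f n * hermite_xi n z) \<le> u * (K * B ^ n)"
      using norm_hermite_xi_le[of n z] unfolding norm_mult u_def K_def B_def
      by (intro mult_left_mono) auto
    also have "\<dots> = K * (u * B ^ n)" by simp
    also have "\<dots> \<le> K * (u\<^sup>2 * 2 ^ (n * p) + (1/4) ^ n)"
      using * K0 by (rule mult_left_mono)
    finally show "norm (norm (f n * hermite_xi n z)) \<le> K * ((cmod (f n))\<^sup>2 * 2 ^ (n * p) + (1/4) ^ n)"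
      by (simp add: u_def)
  qed
qed

end

theory Submission
  imports Defs "HOL-Probability.Distributions"
begin

text \<open>
  Write \<open>F z = exp (- z\<^sup>2 / 2) * g z\<close> and \<open>q = 2 powr (- p)\<close>. Up to the factor
  \<open>\<bar>exp (z\<^sup>2 / 2)\<bar>\<^sup>2\<close> the weight lies between \<open>exp (- 4 * q * \<bar>z\<bar>\<^sup>2)\<close> and \<open>exp (- q * \<bar>z\<bar>\<^sup>2)\<close>, so the
  integral condition for all \<open>p\<close> only says that \<open>g\<close> is square integrable against every Gaussian
  \<open>exp (- \<epsilon> * \<bar>z\<bar>\<^sup>2)\<close>. Hence no orthogonality is needed: Cauchy's inequality for
  \<open>exp (- t\<^sup>2)\<close> gives \<open>\<bar>h\<^sub>n z\<bar> \<le> sqrt (n!) * B ^ n * exp (\<epsilon> * \<bar>z\<bar>\<^sup>2)\<close>, which bounds a Hermite series with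
  rapidly decreasing coefficients. Conversely, averaging Cauchy's formula over all circles against a
  Gaussian bounds the Taylor coefficients of \<open>g\<close> by \<open>C * R ^ (-k) / sqrt (k!)\<close> for every \<open>R\<close>, and
  expanding each monomial in Hermite polynomials turns the Taylor series into a Hermite series.
\<close>

subsection \<open>Lebesgue measure on the complex plane\<close>

text \<open>Lebesgue measure is determined by its values on boxes, and the preimage of a complex box
  is a product of two intervals. This gives access to iterated integrals over real and imaginary
  parts.\<close>

lemma lborel_complex_eq_distr:
  "(lborel :: complex measure) = distr (lborel \<Otimes>\<^sub>M lborel) borel (\<lambda>(x, y). Complex x y)"
proof (rule lborel_eqI)
  have m: "(\<lambda>(x, y). Complex x y) \<in> (lborel \<Otimes>\<^sub>M lborel) \<rightarrow>\<^sub>M borel"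
    unfolding Complex_eq by measurable
  fix l u :: complex
  assume le: "\<And>b. b \<in> Basis \<Longrightarrow> l \<bullet> b \<le> u \<bullet> b"
  have le': "Re l \<le> Re u" "Im l \<le> Im u"
    using le[of 1] le[of \<i>] by (auto simp: Basis_complex_def)
  have "(\<lambda>(x, y). Complex x y) -` box l u = {Re l<..<Re u} \<times> {Im l<..<Im u}"
    by (auto simp: in_box_complex_iff)
  then have "emeasure (distr (lborel \<Otimes>\<^sub>M lborel) borel (\<lambda>(x, y). Complex x y)) (box l u)
      = emeasure (lborel \<Otimes>\<^sub>M lborel) ({Re l<..<Re u} \<times> {Im l<..<Im u})"
    by (subst emeasure_distr[OF m]) (auto simp: space_pair_measure)
  also have "\<dots> = ennreal (\<Prod>b\<in>Basis. (u - l) \<bullet> b)"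
    using le' by (subst lborel.emeasure_pair_measure_Times)
      (auto simp: Basis_complex_def ennreal_mult)
  finally show "emeasure (distr (lborel \<Otimes>\<^sub>M lborel) borel (\<lambda>(x, y). Complex x y)) (box l u) =
    ennreal (\<Prod>b\<in>Basis. (u - l) \<bullet> b)" .
qed simp

lemma measurable_Complex [measurable]: "(\<lambda>(x, y). Complex x y) \<in> borel \<Otimes>\<^sub>M borel \<rightarrow>\<^sub>M borel"
  unfolding Complex_eq by measurable

lemma borel_measurable_Complex [measurable (raw)]:
  assumes [measurable]: "f \<in> borel_measurable M" "g \<in> borel_measurable M"
  shows "(\<lambda>x. Complex (f x) (g x)) \<in> borel_measurable M"
proof -
  have "(\<lambda>x. case (f x, g x) of (u, v) \<Rightarrow> Complex u v) \<in> borel_measurable M"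
    by measurable
  then show ?thesis by simp
qed

text \<open>Tonelli in both orders: a horizontal shear is handled with the real part innermost, a
  vertical one with the imaginary part innermost.\<close>

lemma nn_integral_complex:
  assumes [measurable]: "f \<in> borel_measurable borel"
  shows "(\<integral>\<^sup>+z. f z \<partial>lborel) = (\<integral>\<^sup>+x. \<integral>\<^sup>+y. f (Complex x y) \<partial>lborel \<partial>lborel)"
    and "(\<integral>\<^sup>+z. f z \<partial>lborel) = (\<integral>\<^sup>+y. \<integral>\<^sup>+x. f (Complex x y) \<partial>lborel \<partial>lborel)"
proof -
  have "(\<integral>\<^sup>+z. f z \<partial>lborel) = (\<integral>\<^sup>+p. f (case p of (x, y) \<Rightarrow> Complex x y) \<partial>(lborel \<Otimes>\<^sub>M lborel))"
    by (subst lborel_complex_eq_distr, subst nn_integral_distr) auto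
  then have e: "(\<integral>\<^sup>+z. f z \<partial>lborel) = (\<integral>\<^sup>+(x, y). f (Complex x y) \<partial>(lborel \<Otimes>\<^sub>M lborel))"
    by (simp add: case_prod_unfold)
  show "(\<integral>\<^sup>+z. f z \<partial>lborel) = (\<integral>\<^sup>+x. \<integral>\<^sup>+y. f (Complex x y) \<partial>lborel \<partial>lborel)"
    unfolding e by (subst lborel.nn_integral_fst[symmetric]) auto
  show "(\<integral>\<^sup>+z. f z \<partial>lborel) = (\<integral>\<^sup>+y. \<integral>\<^sup>+x. f (Complex x y) \<partial>lborel \<partial>lborel)"
    unfolding e by (subst lborel_pair.nn_integral_snd[symmetric]) auto
qed

section \<open>Invariance under translations, shears and rotations\<close>

lemma nn_integral_lborel_shift:
  fixes f :: "real \<Rightarrow> ennreal"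
  assumes [measurable]: "f \<in> borel_measurable borel"
  shows "(\<integral>\<^sup>+x. f (x + c) \<partial>lborel) = (\<integral>\<^sup>+x. f x \<partial>lborel)"
proof -
  have "(\<integral>\<^sup>+x. f x \<partial>lborel) = (\<integral>\<^sup>+x. f x \<partial>distr lborel borel ((+) c))"
    by (simp add: lborel_distr_plus)
  also have "\<dots> = (\<integral>\<^sup>+x. f (x + c) \<partial>lborel)"
    by (subst nn_integral_distr) (auto simp: add.commute)
  finally show ?thesis ..
qed

text \<open>On each line parallel to its direction a shear is a translation by a constant, so
  translation invariance of the inner integral is enough.\<close>

lemma nn_integral_complex_shear:
  assumes [measurable]: "f \<in> borel_measurable borel"
  shows "(\<integral>\<^sup>+z. f (Complex (Re z + t * Im z) (Im z)) \<partial>lborel) = (\<integral>\<^sup>+z. f z \<partial>lborel)"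
    and "(\<integral>\<^sup>+z. f (Complex (Re z) (Im z + t * Re z)) \<partial>lborel) = (\<integral>\<^sup>+z. f z \<partial>lborel)"
proof -
  have "(\<integral>\<^sup>+z. f (Complex (Re z + t * Im z) (Im z)) \<partial>lborel)
      = (\<integral>\<^sup>+y. \<integral>\<^sup>+x. f (Complex (x + t * y) y) \<partial>lborel \<partial>lborel)"
    by (subst nn_integral_complex(2)) auto
  also have "\<dots> = (\<integral>\<^sup>+z. f z \<partial>lborel)"
    by (subst nn_integral_complex(2)) (auto simp: nn_integral_lborel_shift[of "\<lambda>x. f (Complex x _)"])
  finally show "(\<integral>\<^sup>+z. f (Complex (Re z + t * Im z) (Im z)) \<partial>lborel) = (\<integral>\<^sup>+z. f z \<partial>lborel)" .
  have "(\<integral>\<^sup>+z. f (Complex (Re z) (Im z + t * Re z)) \<partial>lborel)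
      = (\<integral>\<^sup>+x. \<integral>\<^sup>+y. f (Complex x (y + t * x)) \<partial>lborel \<partial>lborel)"
    by (subst nn_integral_complex(1)) auto
  also have "\<dots> = (\<integral>\<^sup>+z. f z \<partial>lborel)"
    by (subst nn_integral_complex(1)) (auto simp: nn_integral_lborel_shift[of "\<lambda>y. f (Complex _ y)"])
  finally show "(\<integral>\<^sup>+z. f (Complex (Re z) (Im z + t * Re z)) \<partial>lborel) = (\<integral>\<^sup>+z. f z \<partial>lborel)" .
qed

text \<open>A rotation by an angle other than \<open>\<pi>\<close> is a product of three shears.\<close>

lemma nn_integral_rotate_half:
  assumes [measurable]: "f \<in> borel_measurable borel" and v: "cmod v = 1" "Re v \<ge> 0"
  shows "(\<integral>\<^sup>+z. f (v * z) \<partial>lborel) = (\<integral>\<^sup>+z. f z \<partial>lborel)"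
proof -
  define c s where "c = Re v" and "s = Im v"
  \<comment> \<open>For v = exp(i \<theta>) this is tan(\<theta>/2), up to sign the parameter of the
    two outer shears; the middle one has parameter sin \<theta>. The assumption
    \<open>Re v \<ge> 0\<close> keeps the denominator positive.\<close>
  define t where "t = s / (1 + c)"
  have cs: "c\<^sup>2 + s\<^sup>2 = 1" using v(1) by (simp add: c_def s_def cmod_def)
  have c0: "1 + c > 0" using v by (simp add: c_def)
  have "s * s = (1 + c) * (1 - c)" using cs by (simp add: algebra_simps power2_eq_square)
  then have ts: "t * s = 1 - c" using c0 by (simp add: t_def field_simps)
  have tc: "t * (1 + c) = s" using c0 by (simp add: t_def)
  have 1: "x - t * y - t * (y + s * (x - t * y)) = c * x - s * y" for x y
  proof -
    have "x - t * y - t * (y + s * (x - t * y)) = x - t * s * x - t * (2 - t * s) * y"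
      by (simp add: algebra_simps)
    also have "\<dots> = c * x - t * (1 + c) * y" unfolding ts by (simp add: algebra_simps)
    finally show ?thesis by (simp only: tc)
  qed
  have 2: "y + s * (x - t * y) = s * x + c * y" for x y
  proof -
    have "y + s * (x - t * y) = s * x + (1 - t * s) * y" by (simp add: algebra_simps)
    then show ?thesis unfolding ts by simp
  qed
  let ?X = "\<lambda>z. Complex (Re z + (-t) * Im z) (Im z)" and ?Y = "\<lambda>z. Complex (Re z) (Im z + s * Re z)"
  have "v * z = ?X (?Y (?X z))" for z
    using 1[of "Re z" "Im z"] 2[of "Im z" "Re z"] by (simp add: complex_eq_iff c_def s_def)
  then have "(\<integral>\<^sup>+z. f (v * z) \<partial>lborel) = (\<integral>\<^sup>+z. f (?X (?Y (?X z))) \<partial>lborel)" by simp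
  also have "\<dots> = (\<integral>\<^sup>+z. f (?X (?Y z)) \<partial>lborel)"
    by (rule nn_integral_complex_shear(1)[where f = "\<lambda>z. f (?X (?Y z))"]) auto
  also have "\<dots> = (\<integral>\<^sup>+z. f (?X z) \<partial>lborel)"
    by (rule nn_integral_complex_shear(2)[where f = "\<lambda>z. f (?X z)"]) auto
  also have "\<dots> = (\<integral>\<^sup>+z. f z \<partial>lborel)"
    by (rule nn_integral_complex_shear(1)) auto
  finally show ?thesis .
qed

text \<open>The principal square root lies in the closed right half-plane, so every rotation,
  including the one by \<pi>, is a rotation covered by \<open>nn_integral_rotate_half\<close>
  applied twice.\<close>

lemma nn_integral_rotate:
  assumes [measurable]: "f \<in> borel_measurable borel" and u: "cmod u = 1"
  shows "(\<integral>\<^sup>+z. f (u * z) \<partial>lborel) = (\<integral>\<^sup>+z. f z \<partial>lborel)"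
proof -
  define v where "v = csqrt u"
  have v: "cmod v = 1" "Re v \<ge> 0" "u = v * v"
    using u csqrt_principal[of u] by (auto simp: v_def norm_csqrt simp flip: power2_eq_square)
  have "(\<integral>\<^sup>+z. f (u * z) \<partial>lborel) = (\<integral>\<^sup>+z. f (v * (v * z)) \<partial>lborel)"
    by (simp add: v(3) mult.assoc)
  also have "\<dots> = (\<integral>\<^sup>+z. f (v * z) \<partial>lborel)"
    by (rule nn_integral_rotate_half[where f = "\<lambda>z. f (v * z)"]) (use v in auto)
  also have "\<dots> = (\<integral>\<^sup>+z. f z \<partial>lborel)"
    by (rule nn_integral_rotate_half) (use v in auto)
  finally show ?thesis .
qed

section \<open>Finiteness of Gaussian integrals\<close>

lemma nn_integral_gauss_real:
  assumes "\<epsilon> > 0"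
  shows "(\<integral>\<^sup>+x. ennreal (exp (- \<epsilon> * x\<^sup>2)) \<partial>lborel) < \<infinity>"
proof -
  \<comment> \<open>The standard deviation for which the normal density has exponent -\<epsilon>
    x^2.\<close>
  define \<sigma> where "\<sigma> = 1 / sqrt (2 * \<epsilon>)"
  have s: "\<sigma> > 0" using assms by (simp add: \<sigma>_def)
  have s2: "2 * \<sigma>\<^sup>2 = 1 / \<epsilon>" using assms by (simp add: \<sigma>_def power_divide)
  have "exp (- \<epsilon> * x\<^sup>2) = sqrt (2 * pi * \<sigma>\<^sup>2) * normal_density 0 \<sigma> x" for x
    using s assms unfolding normal_density_def s2 by simp
  then have "integrable lborel (\<lambda>x. exp (- \<epsilon> * x\<^sup>2))"
    using s by (auto intro!: integrable_mult_right simp: integrable_normal_density)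
  then show ?thesis by (simp add: integrable_iff_bounded)
qed

lemma nn_integral_gauss_complex:
  assumes "\<epsilon> > 0"
  shows "(\<integral>\<^sup>+z. ennreal (exp (- \<epsilon> * (cmod z)\<^sup>2)) \<partial>lborel) < \<infinity>"
proof -
  let ?I = "\<integral>\<^sup>+x. ennreal (exp (- \<epsilon> * x\<^sup>2)) \<partial>lborel"
  have "exp (- \<epsilon> * (cmod (Complex x y))\<^sup>2) = exp (- \<epsilon> * x\<^sup>2) * exp (- \<epsilon> * y\<^sup>2)" for x y
    by (simp add: cmod_power2 algebra_simps flip: exp_add)
  then have "(\<integral>\<^sup>+z. ennreal (exp (- \<epsilon> * (cmod z)\<^sup>2)) \<partial>lborel) = ?I * ?I"
    by (subst nn_integral_complex(1)) (simp_all add: ennreal_mult nn_integral_cmult nn_integral_multc)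
  then show ?thesis using nn_integral_gauss_real[OF assms] by (simp add: ennreal_mult_less_top)
qed

subsection \<open>Hermite polynomials\<close>

lemma sqrt_fact_le_power: "sqrt (fact n) \<le> sqrt (real n) ^ n"
proof -
  have "sqrt (fact n) \<le> sqrt (real n ^ n)"
    using fact_le_power[of n, where 'a = real] by (simp add: of_nat_power)
  then show ?thesis by (simp add: real_sqrt_power)
qed

text \<open>Cauchy's inequality on the circle of radius r about z. At t = z + u the function exp(-
  t^2) is exp(- z^2) times exp(- 2 z u - u^2); the first factor cancels the exp(z^2) of Rodrigues'
  formula, the second is estimated using |u| = r.\<close>

lemma norm_hermite_h_le_radius:
  assumes r: "r > 0"
  shows "cmod (hermite_h n z) \<le> fact n * exp (2 * cmod z * r + r\<^sup>2) / r ^ n"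
proof -
  let ?B = "exp (2 * cmod z * r + r\<^sup>2) / cmod (exp (z\<^sup>2))"
  have "cmod ((deriv ^^ n) (\<lambda>t. exp (- t\<^sup>2)) z) \<le> fact n * ?B / r ^ n"
  proof (rule Cauchy_inequality[OF _ _ r])
    fix t assume t: "cmod (z - t) = r"
    define u where "u = t - z"
    have u: "cmod u = r" "t = z + u" using t by (auto simp: u_def norm_minus_commute)
    have "- t\<^sup>2 = - z\<^sup>2 + (- 2 * z * u - u\<^sup>2)" unfolding u by (simp add: power2_sum)
    then have "cmod (exp (- t\<^sup>2)) = cmod (exp (- 2 * z * u - u\<^sup>2)) / cmod (exp (z\<^sup>2))"
      by (simp only: exp_add norm_mult exp_minus norm_inverse divide_inverse mult.commute)
    also have "cmod (exp (- 2 * z * u - u\<^sup>2)) \<le> exp (cmod (- 2 * z * u - u\<^sup>2))"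
      by (rule norm_exp)
    also have "cmod (- 2 * z * u - u\<^sup>2) \<le> 2 * cmod z * r + r\<^sup>2"
      using norm_triangle_ineq4[of "- 2 * z * u" "u\<^sup>2"] by (simp add: norm_mult norm_power u)
    finally show "cmod (exp (- t\<^sup>2)) \<le> ?B"
      by (simp add: divide_right_mono del: norm_exp_eq_Re)
  qed (auto intro!: holomorphic_intros continuous_intros)
  then have "cmod (exp (z\<^sup>2)) * cmod ((deriv ^^ n) (\<lambda>t. exp (- t\<^sup>2)) z)
      \<le> cmod (exp (z\<^sup>2)) * (fact n * ?B / r ^ n)"
    by (rule mult_left_mono) simp
  then show ?thesis
    by (simp add: hermite_h_def norm_mult norm_power del: norm_exp_eq_Re)
qed

text \<open>The growth in z can be made an arbitrarily small Gaussian at the price of a larger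
  geometric factor in n, which rapidly decreasing coefficients absorb.\<close>

lemma norm_hermite_h_le:
  assumes e: "\<epsilon> > 0"
  shows "cmod (hermite_h n z) \<le> sqrt (fact n) * exp (1 + 1 / \<epsilon>) ^ n * exp (\<epsilon> * (cmod z)\<^sup>2)"
proof (cases "n = 0")
  case True
  then show ?thesis using e by (simp add: hermite_h_eq_rec)
next
  case False
  \<comment> \<open>With this radius n!/r^n is at most sqrt(n!) and r^2 = n contributes only a
    geometric factor. It must be positive, hence the separate case n = 0.\<close>
  define r where "r = sqrt (real n)"
  have r: "r > 0" "r\<^sup>2 = n" using False by (auto simp: r_def)
  have "sqrt (fact n) * sqrt (fact n) \<le> sqrt (fact n) * r ^ n"
    unfolding r_def by (intro mult_left_mono sqrt_fact_le_power) auto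
  then have f: "fact n / r ^ n \<le> sqrt (fact n)"
    using r by (simp add: field_simps)
  \<comment> \<open>The weighted inequality 2ab \<le> a^2 + b^2 splits the cross term into
    \<epsilon> |z|^2 and n/\<epsilon>.\<close>
  have "2 * cmod z * r * \<epsilon> \<le> (\<epsilon> * cmod z)\<^sup>2 + r\<^sup>2"
    using sum_squares_bound[of "\<epsilon> * cmod z" r] by (simp add: algebra_simps)
  then have "2 * cmod z * r + r\<^sup>2 \<le> \<epsilon> * (cmod z)\<^sup>2 + n * (1 + 1 / \<epsilon>)"
    using e r by (simp add: field_simps power2_eq_square)
  then have "exp (2 * cmod z * r + r\<^sup>2) \<le> exp (1 + 1 / \<epsilon>) ^ n * exp (\<epsilon> * (cmod z)\<^sup>2)"
    by (simp add: mult.commute flip: exp_of_nat_mult exp_add)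
  with f have "fact n / r ^ n * exp (2 * cmod z * r + r\<^sup>2)
      \<le> sqrt (fact n) * (exp (1 + 1 / \<epsilon>) ^ n * exp (\<epsilon> * (cmod z)\<^sup>2))"
    by (rule mult_mono) auto
  then show ?thesis
    using norm_hermite_h_le_radius[OF r(1), of n z] by (simp add: mult_ac)
qed

text \<open>Comparison of the coefficients of t^k in exp(2zt) = exp(t^2) exp(2zt - t^2), where the
  last factor generates h_n(z)/n!. The proof is an induction on k through the three-term
  recurrence.\<close>

lemma power_eq_hermite_sum:
  fixes z :: complex
  shows "(2 * z) ^ k / fact k
    = (\<Sum>m | 2 * m \<le> k. hermite_h (k - 2 * m) z / (fact (k - 2 * m) * fact m))"
proof -
  \<comment> \<open>Extension by \<open>0\<close> to negative indices, so that the recurrence needs no boundary cases.\<close>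
  define \<eta> where "\<eta> i = (if i < 0 then 0 else hermite_rec (nat i) z / fact (nat i))" for i :: int
  have rec: "2 * z * \<eta> i = of_int (i + 1) * \<eta> (i + 1) + 2 * \<eta> (i - 1)" for i
  proof -
    consider "i < -1" | "i = -1" | "i = 0" | n where "i = int (Suc n)"
    proof -
      have "i < -1 \<or> i = -1 \<or> i = 0 \<or> i = int (Suc (nat (i - 1)))" by auto
      then show ?thesis using that by blast
    qed
    then show ?thesis
    proof cases
      case 4
      have a: "2 * z * \<eta> i = 2 * z * hermite_rec (Suc n) z / fact (Suc n)"
        by (simp add: \<eta>_def 4 nat_add_distrib)
      have b: "\<eta> (i - 1) = hermite_rec n z / fact n" by (simp add: \<eta>_def 4)
      have c: "\<eta> (i + 1) = hermite_rec (Suc (Suc n)) z / fact (Suc (Suc n))"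
        by (simp add: \<eta>_def 4 nat_add_distrib del: hermite_rec.simps fact_Suc)
      have i: "of_int (i + 1) = (of_nat (Suc (Suc n)) :: complex)" by (simp add: 4)
      have ne: "of_nat (Suc n) \<noteq> (0::complex)" "of_nat (Suc (Suc n)) \<noteq> (0::complex)"
        using of_nat_neq_0 by blast+
      show ?thesis unfolding a b c i fact_Suc hermite_rec.simps of_nat_mult
        using ne by (simp add: divide_simps del: of_nat_Suc)
    qed (auto simp: \<eta>_def)
  qed
  \<comment> \<open>Summands with 2m > k vanish because \<open>\<eta>\<close> is 0 at negative
    indices, so the range of m may be taken as all m \<le> k.\<close>
  define S where "S k M = (\<Sum>m\<le>M. \<eta> (int k - 2 * int m) / fact m)" for k M
  have "(2 * z) ^ k / fact k = S k k"
  proof (induction k)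
    case 0
    then show ?case by (simp add: S_def \<eta>_def)
  next
    case (Suc k)
    let ?t = "\<lambda>m. \<eta> (int (Suc k) - 2 * int m) / fact m"
    \<comment> \<open>The lowering term of the recurrence at m is moved to m + 1, where 1/m! =
      (m+1)/(m+1)!. The two weights k + 1 - 2m and 2m then add up to k + 1, independently of
      m.\<close>
    have shift: "2 * \<eta> (int k - 2 * int m - 1) / fact m = 2 * of_nat (Suc m) * ?t (Suc m)" for m
    proof -
      have "of_nat (Suc m) \<noteq> (0::complex)" using of_nat_neq_0 by blast
      moreover have "int k - 2 * int m - 1 = int (Suc k) - 2 * int (Suc m)" by simp
      ultimately show ?thesis by (simp only: fact_Suc of_nat_mult) (simp add: divide_simps del: of_nat_Suc)
    qed
    have "2 * z * S k k = (\<Sum>m\<le>k. (2 * z * \<eta> (int k - 2 * int m)) / fact m)"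
      by (simp add: S_def sum_distrib_left)
    also have "\<dots> = (\<Sum>m\<le>k. of_int (int (Suc k) - 2 * int m) * ?t m) + (\<Sum>m\<le>k. 2 * of_nat (Suc m) * ?t (Suc m))"
      unfolding rec sum.distrib[symmetric] add_divide_distrib shift
      by (intro sum.cong refl) (simp add: algebra_simps)
    \<comment> \<open>Both sums are extended by a zero term: here m = 0 carries the factor 0, and in
      the next step m = k + 1 gives \<open>\<eta>\<close> the negative index -(k+1).\<close>
    also have "(\<Sum>m\<le>k. 2 * of_nat (Suc m) * ?t (Suc m)) = (\<Sum>m\<le>Suc k. 2 * of_nat m * ?t m)"
      by (subst sum.atMost_Suc_shift) simp
    also have "(\<Sum>m\<le>k. of_int (int (Suc k) - 2 * int m) * ?t m)
        = (\<Sum>m\<le>Suc k. of_int (int (Suc k) - 2 * int m) * ?t m)"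
      by (simp add: \<eta>_def)
    also have "\<dots> + (\<Sum>m\<le>Suc k. 2 * of_nat m * ?t m) = (\<Sum>m\<le>Suc k. of_nat (Suc k) * ?t m)"
      unfolding sum.distrib[symmetric] distrib_right[symmetric] by (intro sum.cong refl) simp
    also have "\<dots> = of_nat (Suc k) * S (Suc k) (Suc k)"
      by (simp only: S_def sum_distrib_left)
    finally have "2 * z * S k k = of_nat (Suc k) * S (Suc k) (Suc k)" .
    moreover have "(2 * z) ^ Suc k / fact (Suc k) = 2 * z * ((2 * z) ^ k / fact k) / of_nat (Suc k)"
    proof -
      have "a * p / (N * f) = a * (p / f) / N" for a p N f :: complex by simp
      then show ?thesis unfolding power_Suc fact_Suc of_nat_mult .
    qed
    moreover have "of_nat (Suc k) \<noteq> (0::complex)" using of_nat_neq_0 by blast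
    ultimately show ?case unfolding Suc.IH by (metis nonzero_mult_div_cancel_left)
  qed
  also have "S k k = (\<Sum>m | 2 * m \<le> k. hermite_h (k - 2 * m) z / (fact (k - 2 * m) * fact m))"
    unfolding S_def
  proof (rule sum.mono_neutral_cong_right)
    show "\<eta> (int k - 2 * int m) / fact m = hermite_h (k - 2 * m) z / (fact (k - 2 * m) * fact m)"
      if "m \<in> {m. 2 * m \<le> k}" for m
    proof -
      have "int k - 2 * int m = int (k - 2 * m)" using that by auto
      moreover have "\<eta> (int j) = hermite_h j z / fact j" for j
        by (simp add: \<eta>_def hermite_h_eq_rec)
      ultimately show ?thesis by (simp only: divide_divide_eq_left)
    qed
    show "{m. 2 * m \<le> k} \<subseteq> {..k}" by auto
    show "\<forall>m\<in>{..k} - {m. 2 * m \<le> k}. \<eta> (int k - 2 * int m) / fact m = 0"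
      unfolding \<eta>_def by auto
  qed simp
  finally show ?thesis .
qed

text \<open>The multinomial coefficient (n+2m)!/(n! m! m!) is a product of two binomial
  coefficients, each at most 2^(n+2m). Its square root compares the sqrt(k!) of the Taylor bound
  with the sqrt(n!) m! of the Hermite expansion.\<close>

lemma fact_add_twice_le: "fact (n + 2 * m) \<le> (4::real) ^ (n + 2 * m) * (fact n * (fact m)\<^sup>2)"
proof -
  have 1: "fact n * fact (2 * m) * ((n + 2 * m) choose n) = (fact (n + 2 * m) :: nat)"
    using binomial_fact_lemma[of n "n + 2 * m"] by simp
  have 2: "fact m * fact m * ((2 * m) choose m) = (fact (2 * m) :: nat)"
    using binomial_fact_lemma[of m "2 * m"] by (simp add: mult_2)
  have "(fact (n + 2 * m) :: nat)
      = ((n + 2 * m) choose n) * ((2 * m) choose m) * (fact n * (fact m)\<^sup>2)"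
    unfolding 1[symmetric] 2[symmetric] power2_eq_square by (simp only: mult_ac)
  then have "real (fact (n + 2 * m))
      = real (((n + 2 * m) choose n) * ((2 * m) choose m) * (fact n * (fact m)\<^sup>2))"
    by (rule arg_cong)
  then have "(fact (n + 2 * m) :: real)
      = of_nat ((n + 2 * m) choose n) * of_nat ((2 * m) choose m) * (fact n * (fact m)\<^sup>2)"
    by (simp only: of_nat_fact of_nat_mult of_nat_power)
  also have "\<dots> \<le> (2 ^ (n + 2 * m) * 2 ^ (n + 2 * m)) * (fact n * (fact m)\<^sup>2)"
  proof (intro mult_right_mono mult_mono)
    show "real ((n + 2 * m) choose n) \<le> 2 ^ (n + 2 * m)"
      using of_nat_mono[OF binomial_le_pow2[of "n + 2 * m" n], where 'a = real] by simp
    have "real ((2 * m) choose m) \<le> 2 ^ (2 * m)"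
      using of_nat_mono[OF binomial_le_pow2[of "2 * m" m], where 'a = real] by simp
    also have "\<dots> \<le> 2 ^ (n + 2 * m)" by (intro power_increasing) auto
    finally show "real ((2 * m) choose m) \<le> 2 ^ (n + 2 * m)" .
  qed auto
  also have "2 ^ (n + 2 * m) * 2 ^ (n + 2 * m) = (4::real) ^ (n + 2 * m)"
    by (simp flip: power_mult_distrib)
  finally show ?thesis .
qed

text \<open>The geometric majorant makes the double family absolutely summable, so its total is the
  same whether grouped by n or by the degree k = n + 2m. This justifies collecting the terms of
  equal h_n.\<close>

lemma sums_diagonal_eq_sums_iterated:
  fixes c :: "nat \<Rightarrow> nat \<Rightarrow> complex"
  assumes x: "0 \<le> x" "x < 1" and y: "0 \<le> y" "y < 1"
    and le: "\<And>n m. cmod (c n m) \<le> K * (x ^ n * y ^ m)"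
    and s: "(\<lambda>k. \<Sum>m | 2 * m \<le> k. c (k - 2 * m) m) sums s"
  shows "(\<lambda>n. \<Sum>m. c n m) sums s"
proof -
  have g: "((\<lambda>m. u ^ m) has_sum 1 / (1 - u)) UNIV" if "0 \<le> u" "u < 1" for u :: real
    by (rule norm_summable_imp_has_sum) (use that in \<open>auto intro!: summable_geometric geometric_sums simp: norm_power\<close>)
  have "(\<lambda>p. K * (x ^ fst p * y ^ snd p)) summable_on (UNIV \<times> UNIV :: (nat \<times> nat) set)"
  proof (rule summable_on_cmult_right, rule summable_on_SigmaI)
    show "((\<lambda>m. x ^ fst (n, m) * y ^ snd (n, m)) has_sum x ^ n * (1 / (1 - y))) UNIV" for n
      using has_sum_cmult_right[OF g[OF y], of "x ^ n"] by simp
    show "(\<lambda>n. x ^ n * (1 / (1 - y))) summable_on UNIV"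
      using g[OF x] by (intro summable_on_cmult_left) (auto simp: summable_on_def)
  qed (use x y in auto)
  then have "(\<lambda>p. cmod (case p of (n, m) \<Rightarrow> c n m)) summable_on UNIV \<times> UNIV"
    by (rule summable_on_comparison_test) (use le in auto)
  then have S: "(\<lambda>(n, m). c n m) summable_on UNIV \<times> UNIV"
    by (rule abs_summable_summable)
  define t where "t = infsum (\<lambda>(n, m). c n m) (UNIV \<times> UNIV)"
  have t: "((\<lambda>(n, m). c n m) has_sum t) (UNIV \<times> UNIV)"
    unfolding t_def using S by (rule has_sum_infsum)
  have row: "(c n has_sum (\<Sum>m. c n m)) UNIV" for n
  proof (rule norm_summable_imp_has_sum)
    show 1: "summable (\<lambda>m. cmod (c n m))"
    proof (rule summable_comparison_test')
      show "summable (\<lambda>m. (K * x ^ n) * y ^ m)" using y by (intro summable_mult summable_geometric) auto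
    qed (use le[of n] in \<open>simp add: mult_ac\<close>)
    then show "c n sums (\<Sum>m. c n m)" by (intro summable_sums summable_norm_cancel[OF 1])
  qed
  have "((\<lambda>n. \<Sum>m. c n m) has_sum t) UNIV"
    by (rule has_sum_SigmaD[OF t]) (use row in auto)
  then have T: "(\<lambda>n. \<Sum>m. c n m) sums t" by (rule has_sum_imp_sums)
  \<comment> \<open>The bijection (n, m) to (n + 2m, m) has as image exactly the pairs with 2m \<le>
    k, where the natural subtraction does not truncate.\<close>
  have "((\<lambda>(k, m). c (k - 2 * m) m) has_sum t) (Sigma UNIV (\<lambda>k. {m. 2 * m \<le> k}))
      \<longleftrightarrow> ((\<lambda>(n, m). c n m) has_sum t) (UNIV \<times> UNIV)"
    by (rule has_sum_reindex_bij_witness[where i = "\<lambda>(n, m). (n + 2 * m, m)" and j = "\<lambda>(k, m). (k - 2 * m, m)"]) auto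
  with t have "((\<lambda>(k, m). c (k - 2 * m) m) has_sum t) (Sigma UNIV (\<lambda>k. {m. 2 * m \<le> k}))" by blast
  then have "((\<lambda>k. \<Sum>m | 2 * m \<le> k. c (k - 2 * m) m) has_sum t) UNIV"
  proof (rule has_sum_SigmaD)
    fix k :: nat
    have "finite {m. 2 * m \<le> k}" by (rule finite_subset[of _ "{..k}"]) auto
    then show "((\<lambda>m. case (k, m) of (k, m) \<Rightarrow> c (k - 2 * m) m) has_sum (\<Sum>m | 2 * m \<le> k. c (k - 2 * m) m)) {m. 2 * m \<le> k}"
      by simp
  qed
  then have "(\<lambda>k. \<Sum>m | 2 * m \<le> k. c (k - 2 * m) m) sums t" by (rule has_sum_imp_sums)
  with s have "s = t" by (rule sums_unique2)
  with T show ?thesis by simp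
qed

subsection \<open>Taylor coefficients of Gaussian-integrable entire functions\<close>

text \<open>Cauchy's formula on the unit circle, parametrised over [0,1]; the 2\<pi> from the
  velocity cancels the one in the formula. Other radii are reached later by rescaling h.\<close>

lemma taylor_coeff_le_circle_mean:
  assumes h: "h holomorphic_on UNIV"
  shows "ennreal (cmod ((deriv ^^ k) h 0 / fact k))
    \<le> (\<integral>\<^sup>+t\<in>{0..1}. ennreal (cmod (h (exp (2 * of_real pi * \<i> * of_real t)))) \<partial>lborel)"
proof -
  let ?e = "\<lambda>t. exp (2 * of_real pi * \<i> * of_real t) :: complex"
  define G where "G = (\<lambda>t. h (?e t) / ?e t ^ Suc k * (2 * of_real pi * \<i> * ?e t))"
  have hc: "continuous_on S h" for S
    using h holomorphic_on_imp_continuous_on holomorphic_on_subset by blast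
  have "((\<lambda>u. h u / (u - 0) ^ Suc k) has_contour_integral
      (2 * pi * \<i>) / fact k * (deriv ^^ k) h 0) (circlepath 0 1)"
    by (rule Cauchy_has_contour_integral_higher_derivative_circlepath)
      (use h hc holomorphic_on_subset in auto)
  then have "(G has_integral ((2 * pi * \<i>) / fact k * (deriv ^^ k) h 0)) {0..1}"
    unfolding has_contour_integral_def G_def
  proof (rule has_integral_eq[rotated])
    fix t :: real assume t: "t \<in> {0..1}"
    have "vector_derivative (circlepath 0 1) (at t within {0..1}) = 2 * of_real pi * \<i> * ?e t"
      using t by (subst vector_derivative_circlepath01) auto
    then show "h (circlepath 0 1 t) / (circlepath 0 1 t - 0) ^ Suc k *
        vector_derivative (circlepath 0 1) (at t within {0..1}) = h (?e t) / ?e t ^ Suc k * (2 * of_real pi * \<i> * ?e t)"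
      by (simp only:) (simp add: circlepath)
  qed
  moreover have Gc: "continuous_on {0..1} G"
    unfolding G_def by (intro continuous_intros continuous_on_compose2[OF hc[of UNIV]]) auto
  then have Gi: "set_integrable lborel {0..1} G"
    by (rule borel_integrable_atLeastAtMost')
  ultimately have "(LINT t:{0..1}|lborel. G t) = (2 * pi * \<i>) / fact k * (deriv ^^ k) h 0"
    by (metis integral_unique set_borel_integral_eq_integral(2))
  then have "ennreal (cmod ((2 * pi * \<i>) / fact k * (deriv ^^ k) h 0))
      \<le> (\<integral>\<^sup>+t. ennreal (cmod (indicator {0..1} t *\<^sub>R G t)) \<partial>lborel)"
    using integral_norm_bound_ennreal[OF Gi[unfolded set_integrable_def]]
    by (simp add: set_lebesgue_integral_def)
  also have "\<dots> = (\<integral>\<^sup>+t. ennreal (2 * pi) * (ennreal (cmod (h (?e t))) * indicator {0..1} t) \<partial>lborel)"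
  proof (rule nn_integral_cong)
    fix t :: real
    have "cmod (G t) = 2 * pi * cmod (h (?e t))"
      by (simp add: G_def norm_mult norm_divide norm_power)
    then show "ennreal (cmod (indicator {0..1} t *\<^sub>R G t))
        = ennreal (2 * pi) * (ennreal (cmod (h (?e t))) * indicator {0..1} t)"
      by (simp add: indicator_def ennreal_mult)
  qed
  also have "\<dots> = ennreal (2 * pi) * (\<integral>\<^sup>+t\<in>{0..1}. ennreal (cmod (h (?e t))) \<partial>lborel)"
  proof (rule nn_integral_cmult)
    have [measurable]: "h \<in> borel_measurable borel"
      using hc by (rule borel_measurable_continuous_onI)
    show "(\<lambda>t. ennreal (cmod (h (?e t))) * indicator {0..1} t) \<in> borel_measurable lborel"
      by measurable
  qed
  finally have le: "ennreal (2 * pi) * ennreal (cmod ((deriv ^^ k) h 0 / fact k))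
      \<le> ennreal (2 * pi) * (\<integral>\<^sup>+t\<in>{0..1}. ennreal (cmod (h (?e t))) \<partial>lborel)"
    by (simp add: norm_mult norm_divide flip: ennreal_mult)
  then show ?thesis
    by (subst (asm) ennreal_mult_le_mult_iff) auto
qed

text \<open>The circle mean is applied to z \<mapsto> h(w z), whose k-th Taylor coefficient is w^k
  times that of h, and is integrated over w. After exchanging the integrals, rotation invariance
  makes the inner one independent of t; this takes the place of polar coordinates.\<close>

lemma taylor_coeff_nn_integral_le:
  assumes h: "h holomorphic_on UNIV" and W [measurable]: "W \<in> borel_measurable borel"
    and radial: "\<And>u w :: complex. cmod u = 1 \<Longrightarrow> W (u * w) = W w"
  shows "ennreal (cmod ((deriv ^^ k) h 0 / fact k)) * (\<integral>\<^sup>+w. ennreal (cmod w ^ k) * W w \<partial>lborel)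
    \<le> (\<integral>\<^sup>+w. ennreal (cmod (h w)) * W w \<partial>lborel)"
proof -
  let ?e = "\<lambda>t. exp (2 * of_real pi * \<i> * of_real t) :: complex"
  let ?a = "cmod ((deriv ^^ k) h 0 / fact k)"
  have [measurable]: "h \<in> borel_measurable borel"
    using h holomorphic_on_imp_continuous_on borel_measurable_continuous_onI by blast
  have m: "ennreal (?a * cmod w ^ k) \<le> (\<integral>\<^sup>+t\<in>{0..1}. ennreal (cmod (h (w * ?e t))) \<partial>lborel)" for w
  proof -
    have "(deriv ^^ k) (\<lambda>z. h (w * z)) 0 = w ^ k * (deriv ^^ k) h (w * 0)"
      by (rule higher_deriv_compose_linear[where S = UNIV and T = UNIV]) (use h in auto)
    then have "?a * cmod w ^ k = cmod ((deriv ^^ k) (\<lambda>z. h (w * z)) 0 / fact k)"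
      by (simp add: norm_mult norm_divide norm_power)
    also have "ennreal \<dots> \<le> (\<integral>\<^sup>+t\<in>{0..1}. ennreal (cmod (h (w * ?e t))) \<partial>lborel)"
      by (rule taylor_coeff_le_circle_mean)
        (intro holomorphic_on_compose_gen[OF _ h, unfolded o_def] holomorphic_intros, auto)
    finally show ?thesis .
  qed
  have "ennreal ?a * (\<integral>\<^sup>+w. ennreal (cmod w ^ k) * W w \<partial>lborel)
      = (\<integral>\<^sup>+w. ennreal (?a * cmod w ^ k) * W w \<partial>lborel)"
    by (subst nn_integral_cmult[symmetric]) (auto simp: ennreal_mult mult.assoc)
  also have "\<dots> \<le> (\<integral>\<^sup>+w. (\<integral>\<^sup>+t\<in>{0..1}. ennreal (cmod (h (w * ?e t))) \<partial>lborel) * W w \<partial>lborel)"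
    by (intro nn_integral_mono mult_right_mono m) auto
  also have "\<dots> = (\<integral>\<^sup>+w. \<integral>\<^sup>+t. ennreal (cmod (h (w * ?e t))) * W w * indicator {0..1} t \<partial>lborel \<partial>lborel)"
    by (subst nn_integral_multc[symmetric]) (auto simp: mult_ac)
  also have "\<dots> = (\<integral>\<^sup>+t. \<integral>\<^sup>+w. ennreal (cmod (h (w * ?e t))) * W w * indicator {0..1} t \<partial>lborel \<partial>lborel)"
    by (rule lborel_pair.Fubini') measurable
  also have "\<dots> = (\<integral>\<^sup>+t\<in>{0..1}. (\<integral>\<^sup>+w. ennreal (cmod (h w)) * W w \<partial>lborel) \<partial>(lborel :: real measure))"
  proof (rule nn_integral_cong)
    fix t :: real
    have "(\<integral>\<^sup>+w. ennreal (cmod (h (w * ?e t))) * W w \<partial>lborel)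
        = (\<integral>\<^sup>+w. ennreal (cmod (h (?e t * w))) * W (?e t * w) \<partial>lborel)"
      using radial[of "?e t"] by (simp add: mult.commute)
    also have "\<dots> = (\<integral>\<^sup>+w. ennreal (cmod (h w)) * W w \<partial>lborel)"
      by (rule nn_integral_rotate[where f = "\<lambda>w. ennreal (cmod (h w)) * W w"]) auto
    finally show "(\<integral>\<^sup>+w. ennreal (cmod (h (w * ?e t))) * W w * indicator {0..1} t \<partial>lborel)
        = (\<integral>\<^sup>+w. ennreal (cmod (h w)) * W w \<partial>lborel) * indicator {0..1} t"
      by (simp add: nn_integral_multc)
  qed
  also have "\<dots> = (\<integral>\<^sup>+w. ennreal (cmod (h w)) * W w \<partial>lborel)"
    by (subst nn_integral_cmult) auto
  finally show ?thesis .
qed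

text \<open>The weighted mean bounds the k-th coefficient by a constant over the k-th absolute
  moment of a Gaussian. That moment grows like k^(k/2) times a geometric factor, which is made as
  large as desired by taking \<epsilon> small.\<close>

lemma taylor_coeff_bound_of_gauss_integrable:
  assumes h: "h holomorphic_on UNIV"
    and I: "\<And>\<epsilon>. \<epsilon> > 0 \<Longrightarrow> (\<integral>\<^sup>+z. ennreal ((cmod (h z))\<^sup>2 * exp (- \<epsilon> * (cmod z)\<^sup>2)) \<partial>lborel) < \<infinity>"
    and R: "R > 0"
  shows "\<exists>C\<ge>0. \<forall>k. cmod ((deriv ^^ k) h 0 / fact k) * sqrt (fact k) * R ^ k \<le> C"
proof -
  \<comment> \<open>Chosen so that the radius \<rho> = sqrt(k/(8\<epsilon>)) used below satisfies
    sqrt(k) R = \<rho> exp(-1/2) exactly.\<close>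
  define \<epsilon> where "\<epsilon> = 1 / (8 * R\<^sup>2 * exp 1)"
  have e: "\<epsilon> > 0" using R by (simp add: \<epsilon>_def)
  let ?W = "\<lambda>z::complex. ennreal (exp (- \<epsilon> * (cmod z)\<^sup>2))"
  let ?a = "\<lambda>k. cmod ((deriv ^^ k) h 0 / fact k)"
  define J where "J = (\<integral>\<^sup>+z. ennreal (cmod (h z)) * ?W z \<partial>lborel)"
  have [measurable]: "h \<in> borel_measurable borel"
    using h holomorphic_on_imp_continuous_on borel_measurable_continuous_onI by blast
  \<comment> \<open>The bound |h| \<le> 1 + |h|^2 reduces the first-power integral to the Gaussian
    mass and the square integrability hypothesis.\<close>
  have "J \<le> (\<integral>\<^sup>+z. ?W z + ennreal ((cmod (h z))\<^sup>2 * exp (- \<epsilon> * (cmod z)\<^sup>2)) \<partial>lborel)"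
    unfolding J_def
  proof (rule nn_integral_mono)
    fix z
    have "2 * cmod (h z) \<le> 1 + (cmod (h z))\<^sup>2" using sum_squares_bound[of 1 "cmod (h z)"] by simp
    then have "cmod (h z) \<le> 1 + (cmod (h z))\<^sup>2" using norm_ge_zero[of "h z"] by linarith
    then have "cmod (h z) * exp (- \<epsilon> * (cmod z)\<^sup>2) \<le> (1 + (cmod (h z))\<^sup>2) * exp (- \<epsilon> * (cmod z)\<^sup>2)"
      by (intro mult_right_mono) auto
    then show "ennreal (cmod (h z)) * ?W z
        \<le> ?W z + ennreal ((cmod (h z))\<^sup>2 * exp (- \<epsilon> * (cmod z)\<^sup>2))"
      by (simp add: algebra_simps flip: ennreal_mult ennreal_plus)
  qed
  also have "\<dots> < \<infinity>"
    using nn_integral_gauss_complex[OF e] I[OF e] by (subst nn_integral_add) auto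
  finally have J: "J < \<infinity>" .
  define j where "j = enn2real J"
  have j: "J = ennreal j" "j \<ge> 0" using J by (auto simp: j_def)
  \<comment> \<open>The moment is bounded below by its part over the unit square with lower left
    corner \<rho> + i\<rho>, which has area 1 and on which \<rho> \<le> |w| and |w|^2 \<le>
    2(\<rho>+1)^2.\<close>
  have key: "?a k * (\<rho> ^ k * exp (- 2 * \<epsilon> * (\<rho> + 1)\<^sup>2)) \<le> j" if \<rho>: "\<rho> \<ge> 0" for k \<rho>
  proof -
    let ?Q = "cbox (Complex \<rho> \<rho>) (Complex (\<rho> + 1) (\<rho> + 1))"
    let ?c = "\<rho> ^ k * exp (- 2 * \<epsilon> * (\<rho> + 1)\<^sup>2)"
    have "ennreal ?c = (\<integral>\<^sup>+w. ennreal ?c * indicator ?Q w \<partial>lborel)"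
      by (simp add: nn_integral_cmult_indicator emeasure_lborel_cbox_eq Basis_complex_def)
    also have "\<dots> \<le> (\<integral>\<^sup>+w. ennreal (cmod w ^ k) * ?W w \<partial>lborel)"
    proof (rule nn_integral_mono)
      fix w :: complex
      show "ennreal ?c * indicator ?Q w \<le> ennreal (cmod w ^ k) * ?W w"
      proof (cases "w \<in> ?Q")
        case True
        then have b: "\<rho> \<le> Re w" "Re w \<le> \<rho> + 1" "\<rho> \<le> Im w" "Im w \<le> \<rho> + 1"
          by (auto simp: in_cbox_complex_iff)
        have "\<rho> \<le> cmod w" using b abs_Re_le_cmod[of w] by linarith
        then have 1: "\<rho> ^ k \<le> cmod w ^ k" using \<rho> by (intro power_mono)
        have "(Re w)\<^sup>2 \<le> (\<rho> + 1)\<^sup>2" "(Im w)\<^sup>2 \<le> (\<rho> + 1)\<^sup>2" using b \<rho> by (auto intro!: power_mono)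
        then have "(cmod w)\<^sup>2 \<le> 2 * (\<rho> + 1)\<^sup>2" by (simp add: cmod_power2)
        then have "exp (- 2 * \<epsilon> * (\<rho> + 1)\<^sup>2) \<le> exp (- \<epsilon> * (cmod w)\<^sup>2)" using e by simp
        with 1 have "?c \<le> cmod w ^ k * exp (- \<epsilon> * (cmod w)\<^sup>2)" using \<rho> by (intro mult_mono) auto
        then show ?thesis using True by (simp flip: ennreal_mult)
      qed simp
    qed
    finally have "ennreal (?a k) * ennreal ?c
        \<le> ennreal (?a k) * (\<integral>\<^sup>+w. ennreal (cmod w ^ k) * ?W w \<partial>lborel)"
      by (rule mult_left_mono) simp
    also have "\<dots> \<le> J"
      unfolding J_def by (rule taylor_coeff_nn_integral_le) (auto simp: h norm_mult)
    finally show ?thesis using j \<rho> by (simp flip: ennreal_mult)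
  qed
  show ?thesis
  proof (intro exI[of _ "j * exp (4 * \<epsilon>)"] conjI allI)
    fix k
    \<comment> \<open>This radius minimises \<open>\<rho> powr (-k) * exp (4 * \<epsilon> * \<rho>\<^sup>2)\<close>.\<close>
    define \<rho> where "\<rho> = sqrt (real k / (8 * \<epsilon>))"
    have \<rho>: "\<rho> \<ge> 0" "4 * \<epsilon> * \<rho>\<^sup>2 = real k / 2" using e by (auto simp: \<rho>_def)
    \<comment> \<open>Removing the shift by 1 doubles the quadratic exponent and costs the factor
      exp(4\<epsilon>), which does not depend on k.\<close>
    have "(\<rho> + 1)\<^sup>2 \<le> 2 * \<rho>\<^sup>2 + 2"
      using sum_squares_bound[of \<rho> 1] by (simp add: power2_sum)
    then have "2 * \<epsilon> * (\<rho> + 1)\<^sup>2 \<le> 2 * \<epsilon> * (2 * \<rho>\<^sup>2 + 2)"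
      using e by (intro mult_left_mono) auto
    also have "\<dots> = real k / 2 + 4 * \<epsilon>" using \<rho>(2) by (simp add: algebra_simps)
    finally have exp_le: "exp (- (real k / 2)) \<le> exp (4 * \<epsilon>) * exp (- 2 * \<epsilon> * (\<rho> + 1)\<^sup>2)"
      by (simp flip: exp_add)
    have "R = 1 / (sqrt (8 * \<epsilon>) * exp (1 / 2))"
    proof -
      have "sqrt (exp 1) = (exp (1/2) :: real)"
        by (rule real_sqrt_unique) (simp_all flip: exp_double)
      then show ?thesis
        using R by (simp add: \<epsilon>_def real_sqrt_divide real_sqrt_mult)
    qed
    then have "sqrt (real k) * R = \<rho> * exp (- (1 / 2))"
      by (simp add: \<rho>_def real_sqrt_divide exp_minus field_simps)
    then have "(sqrt (real k) * R) ^ k = \<rho> ^ k * exp (- (real k / 2))"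
      by (simp add: power_mult_distrib flip: exp_of_nat_mult)
    then have "sqrt (fact k) * R ^ k \<le> \<rho> ^ k * exp (- (real k / 2))"
      using mult_right_mono[OF sqrt_fact_le_power[of k], of "R ^ k"] R
      by (simp add: power_mult_distrib)
    also have "\<dots> \<le> \<rho> ^ k * (exp (4 * \<epsilon>) * exp (- 2 * \<epsilon> * (\<rho> + 1)\<^sup>2))"
      using exp_le \<rho> by (intro mult_left_mono) auto
    finally have "?a k * (sqrt (fact k) * R ^ k)
        \<le> ?a k * (\<rho> ^ k * (exp (4 * \<epsilon>) * exp (- 2 * \<epsilon> * (\<rho> + 1)\<^sup>2)))"
      by (rule mult_left_mono) simp
    also have "\<dots> = exp (4 * \<epsilon>) * (?a k * (\<rho> ^ k * exp (- 2 * \<epsilon> * (\<rho> + 1)\<^sup>2)))"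
      by (simp only: mult_ac)
    also have "\<dots> \<le> exp (4 * \<epsilon>) * j" by (rule mult_left_mono[OF key[OF \<rho>(1)]]) simp
    finally show "?a k * sqrt (fact k) * R ^ k \<le> j * exp (4 * \<epsilon>)" by (simp add: mult_ac)
  qed (use j in auto)
qed

subsection \<open>Hermite series\<close>

text \<open>The normalisation of \<open>hermite_xi\<close> absorbs the sqrt(n!) in
  \<open>norm_hermite_h_le\<close>.\<close>

lemma hermite_xi_const_le_1: "pi powr (-1/4) * (2 ^ n * fact n) powr (-1/2) * sqrt (fact n) \<le> 1"
proof -
  have "pi powr (-1/4) \<le> 1 powr (-1/4)" by (rule powr_mono2') (use pi_ge_two in auto)
  moreover have "(2 ^ n * fact n :: real) powr (-1/2) * sqrt (fact n) \<le> 1"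
  proof -
    have "(2 ^ n * fact n :: real) powr (-1/2) \<le> fact n powr (-1/2)"
      by (rule powr_mono2') auto
    then have "(2 ^ n * fact n :: real) powr (-1/2) * sqrt (fact n) \<le> fact n powr (-1/2) * sqrt (fact n)"
      by (rule mult_right_mono) simp
    also have "\<dots> = fact n powr (-1/2) * fact n powr (1/2)" by (simp add: powr_half_sqrt)
    also have "\<dots> = 1" by (simp flip: powr_add)
    finally show ?thesis .
  qed
  ultimately show ?thesis
    using mult_mono[of "pi powr (-1/4)" 1 "(2 ^ n * fact n) powr (-1/2) * sqrt (fact n)" 1]
    by (simp add: mult.assoc)
qed

lemma rapid_coeffs_bound:
  assumes f: "f \<in> rapid_coeffs" and R: "R > 0"
  shows "\<exists>C\<ge>0. \<forall>n. cmod (f n) * R ^ n \<le> C"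
proof -
  obtain q :: nat where q: "R < 2 ^ q" using real_arch_pow[of 2 R] by auto
  \<comment> \<open>The exponent 2q gives R^(2n) \<le> 2^(np); the successor ensures p \<ge> 1, as
    \<open>rapid_coeffs\<close> demands.\<close>
  define p where "p = Suc (2 * q)"
  have "summable (\<lambda>n. (cmod (f n))\<^sup>2 * 2 ^ (n * p))"
    using f by (auto simp: rapid_coeffs_def p_def)
  then have "Bseq (\<lambda>n. (cmod (f n))\<^sup>2 * 2 ^ (n * p))"
    by (meson convergentI convergent_imp_Bseq summable_LIMSEQ_zero)
  then obtain K where K: "K > 0" "\<And>n. norm ((cmod (f n))\<^sup>2 * 2 ^ (n * p)) \<le> K"
    by (rule BseqE) blast
  have "cmod (f n) * R ^ n \<le> sqrt K" for n
  proof (rule real_le_rsqrt)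
    have "(R ^ n)\<^sup>2 \<le> ((2 ^ q) ^ n)\<^sup>2" using q R by (intro power_mono) auto
    also have "\<dots> = 2 ^ (n * (2 * q))" by (simp add: mult_ac flip: power_mult)
    also have "\<dots> \<le> 2 ^ (n * p)" by (intro power_increasing) (auto simp: p_def)
    finally have "(cmod (f n))\<^sup>2 * (R ^ n)\<^sup>2 \<le> (cmod (f n))\<^sup>2 * 2 ^ (n * p)"
      by (intro mult_left_mono) auto
    then show "(cmod (f n) * R ^ n)\<^sup>2 \<le> K" using K(2)[of n] by (simp add: power_mult_distrib)
  qed
  then show ?thesis using K(1) by (intro exI[of _ "sqrt K"]) auto
qed

text \<open>Decay of the coefficients at rate 2B beats the factor B^n of the Hermite bound and
  leaves (1/2)^n. Since n and z are separated, one estimate serves both locally uniform convergence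
  and growth.\<close>

lemma norm_hermite_series_term_le:
  assumes f: "f \<in> rapid_coeffs" and e: "\<epsilon> > 0"
  shows "\<exists>C\<ge>0. \<forall>n z. cmod (f n * hermite_xi n z)
    \<le> C * (1 / 2) ^ n * (exp (\<epsilon> * (cmod z)\<^sup>2) * cmod (exp (- z\<^sup>2 / 2)))"
proof -
  define B where "B = exp (1 + 1 / \<epsilon>)"
  have B: "B > 0" by (simp add: B_def)
  obtain C where C: "C \<ge> 0" "\<And>n. cmod (f n) * (2 * B) ^ n \<le> C"
    using rapid_coeffs_bound[OF f, of "2 * B"] B by auto
  show ?thesis
  proof (intro exI[of _ C] conjI allI C(1))
    fix n z
    let ?k = "pi powr (-1/4) * (2 ^ n * fact n) powr (-1/2) :: real"
    let ?E = "exp (\<epsilon> * (cmod z)\<^sup>2)" and ?G = "cmod (exp (- z\<^sup>2 / 2))"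
    have "cmod (f n * hermite_xi n z) = cmod (f n) * ?k * ?G * cmod (hermite_h n z)"
      by (simp add: hermite_xi_def norm_mult del: norm_exp_eq_Re)
    also have "\<dots> \<le> cmod (f n) * ?k * ?G * (sqrt (fact n) * B ^ n * ?E)"
      unfolding B_def by (intro mult_left_mono norm_hermite_h_le e) auto
    also have "\<dots> = (?k * sqrt (fact n)) * (cmod (f n) * B ^ n * (?E * ?G))"
      by (simp only: mult_ac)
    also have "\<dots> \<le> 1 * (cmod (f n) * B ^ n * (?E * ?G))"
      using B by (intro mult_right_mono hermite_xi_const_le_1) (auto simp del: norm_exp_eq_Re)
    also have "\<dots> = (cmod (f n) * (2 * B) ^ n) * ((1 / 2) ^ n * (?E * ?G))"
      by (simp add: power_mult_distrib power_divide del: norm_exp_eq_Re)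
    also have "\<dots> \<le> C * ((1 / 2) ^ n * (?E * ?G))"
      by (intro mult_right_mono C) (auto simp del: norm_exp_eq_Re)
    finally show "cmod (f n * hermite_xi n z) \<le> C * (1 / 2) ^ n * (?E * ?G)"
      by (simp only: mult.assoc)
  qed
qed

lemma hermite_series_entire:
  assumes f: "f \<in> rapid_coeffs"
  shows "(\<lambda>z. \<Sum>n. f n * hermite_xi n z) holomorphic_on UNIV"
proof -
  have hd: "(\<lambda>z. f n * hermite_xi n z) field_differentiable at x" for n x
  proof -
    have "(\<lambda>z. f n * hermite_xi n z) holomorphic_on UNIV"
      unfolding hermite_xi_def hermite_h_def deriv_gauss
    proof (intro holomorphic_intros)
      show "hermite_rec n holomorphic_on UNIV"
      proof (cases n)
        case 0
        then have "hermite_rec n = (\<lambda>z. 1 :: complex)" by auto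
        then show ?thesis by simp
      next
        case (Suc m)
        then show ?thesis
          using hermite_rec_deriv[of m] by (auto simp: holomorphic_on_def field_differentiable_def
            intro: has_field_derivative_at_within)
      qed
    qed auto
    then show ?thesis by (simp add: holomorphic_on_open field_differentiable_def)
  qed
  obtain C where C: "C \<ge> 0" "\<And>n z. cmod (f n * hermite_xi n z)
    \<le> C * (1 / 2) ^ n * (exp (1 * (cmod z)\<^sup>2) * cmod (exp (- z\<^sup>2 / 2)))"
    using norm_hermite_series_term_le[OF f, of 1] by auto
  obtain g where g: "\<forall>x\<in>UNIV. (\<lambda>n. f n * hermite_xi n x) sums g x \<and> g field_differentiable at x"
  proof (rule series_differentiable_comparison_complex[OF open_UNIV hd])
    fix x :: complex
    \<comment> \<open>A bound for the z-dependent factor of the majorant on the unit ball about x,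
      as the Weierstrass test requires.\<close>
    define M where "M = exp ((cmod x + 1)\<^sup>2) * exp ((cmod x + 1)\<^sup>2 / 2)"
    have "cmod (f n * hermite_xi n y) \<le> C * (1 / 2) ^ n * M" if y: "y \<in> ball x 1" for n y
    proof -
      have "cmod y \<le> cmod x + 1"
        using y norm_triangle_sub[of y x] by (simp add: dist_norm norm_minus_commute)
      then have y2: "(cmod y)\<^sup>2 \<le> (cmod x + 1)\<^sup>2" by (intro power_mono) auto
      have "cmod (exp (- y\<^sup>2 / 2)) \<le> exp (cmod (- y\<^sup>2 / 2))" by (rule norm_exp)
      also have "\<dots> \<le> exp ((cmod x + 1)\<^sup>2 / 2)" using y2 by (simp add: norm_divide norm_power)
      finally have "exp (1 * (cmod y)\<^sup>2) * cmod (exp (- y\<^sup>2 / 2)) \<le> M"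
        unfolding M_def using y2 by (intro mult_mono) auto
      then have "C * (1 / 2) ^ n * (exp (1 * (cmod y)\<^sup>2) * cmod (exp (- y\<^sup>2 / 2))) \<le> C * (1 / 2) ^ n * M"
        using C(1) by (intro mult_left_mono) auto
      with C(2)[of n y] show ?thesis by linarith
    qed
    moreover have "summable (\<lambda>n. complex_of_real (C * (1 / 2) ^ n * M))"
      by (intro summable_of_real summable_mult2 summable_mult summable_geometric) auto
    moreover have "M \<ge> 0" by (simp add: M_def)
    ultimately show "\<exists>d h. 0 < d \<and> summable h \<and> range h \<subseteq> \<real>\<^sub>\<ge>\<^sub>0 \<and>
        (\<forall>\<^sub>F n in sequentially. \<forall>y\<in>ball x d \<inter> UNIV. cmod (f n * hermite_xi n y) \<le> cmod (h n))"
      using C(1)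
      by (intro exI[of _ 1] exI[of _ "\<lambda>n. complex_of_real (C * (1 / 2) ^ n * M)"])
        (auto simp: nonneg_Reals_of_real_iff abs_mult simp del: of_real_mult of_real_power)
  qed auto
  then have "(\<lambda>z. \<Sum>n. f n * hermite_xi n z) = g" by (auto simp: fun_eq_iff sums_iff)
  then show ?thesis using g
    by (auto simp: holomorphic_on_def intro: field_differentiable_at_within)
qed

lemma hermite_series_growth:
  assumes f: "f \<in> rapid_coeffs" and e: "\<epsilon> > 0"
  shows "\<exists>C\<ge>0. \<forall>z. cmod (\<Sum>n. f n * hermite_xi n z)
    \<le> C * (exp (\<epsilon> * (cmod z)\<^sup>2) * cmod (exp (- z\<^sup>2 / 2)))"
proof -
  obtain C where C: "C \<ge> 0" "\<And>n z. cmod (f n * hermite_xi n z)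
    \<le> C * (1 / 2) ^ n * (exp (\<epsilon> * (cmod z)\<^sup>2) * cmod (exp (- z\<^sup>2 / 2)))"
    using norm_hermite_series_term_le[OF f e] by auto
  have "cmod (\<Sum>n. f n * hermite_xi n z)
      \<le> 2 * C * (exp (\<epsilon> * (cmod z)\<^sup>2) * cmod (exp (- z\<^sup>2 / 2)))" for z
  proof -
    let ?D = "exp (\<epsilon> * (cmod z)\<^sup>2) * cmod (exp (- z\<^sup>2 / 2))"
    have s: "(\<lambda>n. C * (1 / 2) ^ n * ?D) sums (C * 2 * ?D)"
      using geometric_sums[of "1 / 2 :: real"] by (intro sums_mult2 sums_mult) simp
    have "cmod (\<Sum>n. f n * hermite_xi n z) \<le> (\<Sum>n. C * (1 / 2) ^ n * ?D)"
      by (rule norm_suminf_le[OF C(2)]) (use s in \<open>simp add: sums_iff\<close>)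
    then show ?thesis using s by (simp add: sums_iff mult.commute)
  qed
  then show ?thesis using C(1) by (intro exI[of _ "2 * C"]) auto
qed

text \<open>Each monomial is expanded by \<open>power_eq_hermite_sum\<close> and the terms with the
  same h_n are collected. Superexponential control of the Taylor coefficients pays for the
  reordering and for the decay of the new coefficients.\<close>

lemma hermite_expansion_of_power_series:
  fixes a :: "nat \<Rightarrow> complex"
  assumes a: "\<And>R. R > 0 \<Longrightarrow> \<exists>C\<ge>0. \<forall>k. cmod (a k) * sqrt (fact k) * R ^ k \<le> C"
    and g: "\<And>z. (\<lambda>k. a k * z ^ k) sums g z"
  shows "\<exists>f\<in>rapid_coeffs. \<forall>z. (\<lambda>n. f n * hermite_xi n z) sums (exp (- z\<^sup>2 / 2) * g z)"
proof -
  \<comment> \<open>The contribution of the monomial of degree \<open>n + 2 * m\<close> to the coefficient of \<open>h\<^sub>n\<close>.\<close>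
  define c where "c n m = a (n + 2 * m) * fact (n + 2 * m) / (2 ^ (n + 2 * m) * (fact n * fact m))" for n m
  \<comment> \<open>With k = n + 2m, \<open>fact_add_twice_le\<close> makes the factorials and the
    power 2^k cancel exactly, so that |c n m| sqrt(n!) \<le> |a k| sqrt(k!).\<close>
  have c_bound: "\<exists>C\<ge>0. \<forall>n m. cmod (c n m) * sqrt (fact n) \<le> C * ((1 / R) ^ n * (1 / R\<^sup>2) ^ m)"
    if R: "R > 0" for R
  proof -
    obtain C where C: "C \<ge> 0" "\<And>k. cmod (a k) * sqrt (fact k) * R ^ k \<le> C"
      using a[OF R] by auto
    have "cmod (c n m) * sqrt (fact n) \<le> C * ((1 / R) ^ n * (1 / R\<^sup>2) ^ m)" for n m
    proof -
      define k where "k = n + 2 * m"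
      have "sqrt (fact k) \<le> sqrt (4 ^ k * (fact n * (fact m)\<^sup>2))"
        unfolding k_def by (intro real_sqrt_le_mono fact_add_twice_le)
      also have "\<dots> = 2 ^ k * (sqrt (fact n) * fact m)"
        by (simp add: real_sqrt_mult real_sqrt_power)
      finally have f: "sqrt (fact k) \<le> 2 ^ k * (sqrt (fact n) * fact m)" .
      have "cmod (c n m) * sqrt (fact n) * (2 ^ k * (fact n * fact m)) = cmod (a k) * fact k * sqrt (fact n)"
        by (simp add: c_def k_def norm_mult norm_divide norm_power)
      also have "\<dots> = (cmod (a k) * sqrt (fact k)) * (sqrt (fact k) * sqrt (fact n))"
        by simp
      also have "\<dots> \<le> (cmod (a k) * sqrt (fact k)) * ((2 ^ k * (sqrt (fact n) * fact m)) * sqrt (fact n))"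
        using f by (intro mult_left_mono mult_right_mono) auto
      also have "\<dots> = cmod (a k) * sqrt (fact k) * (2 ^ k * (fact n * fact m))"
        by simp
      finally have "cmod (c n m) * sqrt (fact n) \<le> cmod (a k) * sqrt (fact k)"
        by (rule mult_right_le_imp_le) simp
      also have "\<dots> \<le> C / R ^ k" using C(2)[of k] R by (simp add: pos_le_divide_eq)
      also have "\<dots> = C * ((1 / R) ^ n * (1 / R\<^sup>2) ^ m)"
        by (simp add: k_def power_add power_mult power_divide)
      finally show ?thesis .
    qed
    then show ?thesis using C(1) by blast
  qed
  define K :: "nat \<Rightarrow> real" where "K n = pi powr (-1/4) * (2 ^ n * fact n) powr (-1/2)" for n
  have K: "K n > 0" for n by (simp add: K_def)
  define f where "f n = (\<Sum>m. c n m) / of_real (K n)" for n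
  have "f \<in> rapid_coeffs"
    unfolding rapid_coeffs_def
  proof (intro CollectI allI impI)
    fix p :: nat
    \<comment> \<open>R depends on p while \<open>f\<close> does not. The ratio of the final
      geometric series is (2/R)^2 2^p = 4 * 2^p / R^2, which this choice keeps below 1/2; R^2 \<ge>
      2 bounds the sum over m by a factor 2.\<close>
    define R :: real where "R = 2 ^ (p + 2)"
    have R: "R > 0" "R\<^sup>2 \<ge> 2" "4 * 2 ^ p / R\<^sup>2 \<le> 1 / 2"
    proof -
      have p1: "(2::real) ^ p \<ge> 1" by simp
      have r: "R\<^sup>2 = 16 * (2 ^ p * 2 ^ p)" by (simp add: R_def power_add power2_eq_square)
      have "1 * 1 \<le> (2::real) ^ p * 2 ^ p" using p1 by (intro mult_mono) auto
      then show "R\<^sup>2 \<ge> 2" unfolding r by simp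
      have "1 * 2 ^ p \<le> (2::real) ^ p * 2 ^ p" using p1 by (intro mult_right_mono) auto
      then show "4 * 2 ^ p / R\<^sup>2 \<le> 1 / 2" unfolding r by (simp add: field_simps) (use p1 in linarith)
    qed (simp add: R_def)
    obtain C where C: "C \<ge> 0" "\<And>n m. cmod (c n m) * sqrt (fact n) \<le> C * ((1 / R) ^ n * (1 / R\<^sup>2) ^ m)"
      using c_bound[OF R(1)] by auto
    define D where "D = 2 * C * pi powr (1/4)"
    have fn: "cmod (f n) \<le> D * (2 / R) ^ n" for n
    proof -
      let ?q = "1 / R\<^sup>2"
      have q: "0 \<le> ?q" "?q \<le> 1 / 2" using R by (auto simp: field_simps)
      have s: "(\<lambda>m. C * (1 / R) ^ n / sqrt (fact n) * ?q ^ m) sums (C * (1 / R) ^ n / sqrt (fact n) * (1 / (1 - ?q)))"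
        using q by (intro sums_mult geometric_sums) auto
      have "cmod (\<Sum>m. c n m) \<le> (\<Sum>m. C * (1 / R) ^ n / sqrt (fact n) * ?q ^ m)"
      proof (rule norm_suminf_le)
        show "cmod (c n m) \<le> C * (1 / R) ^ n / sqrt (fact n) * ?q ^ m" for m
        proof -
          have "cmod (c n m) \<le> C * ((1 / R) ^ n * ?q ^ m) / sqrt (fact n)"
            using C(2)[of n m] by (subst pos_le_divide_eq) simp_all
          then show ?thesis by (simp only: mult.assoc times_divide_eq_left)
        qed
      qed (use s in \<open>simp add: sums_iff\<close>)
      also have "\<dots> = C * (1 / R) ^ n / sqrt (fact n) * (1 / (1 - ?q))" using s by (simp add: sums_iff)
      also have "\<dots> \<le> C * (1 / R) ^ n / sqrt (fact n) * 2"
        using q C(1) R by (intro mult_left_mono) (auto simp: field_simps)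
      finally have 1: "cmod (\<Sum>m. c n m) \<le> C * (1 / R) ^ n / sqrt (fact n) * 2" .
      have K1: "1 / K n = pi powr (1/4) * (sqrt (2 ^ n) * sqrt (fact n))"
      proof -
        have "1 / K n = pi powr (1/4) * (2 ^ n * fact n) powr (1/2)"
          unfolding K_def by (simp add: powr_minus divide_simps)
        then show ?thesis by (simp add: powr_half_sqrt real_sqrt_mult)
      qed
      have "cmod (f n) = cmod (\<Sum>m. c n m) * (1 / K n)"
        using K[of n] by (simp add: f_def norm_divide)
      also have "\<dots> \<le> (C * (1 / R) ^ n / sqrt (fact n) * 2) * (1 / K n)"
        using 1 K[of n] by (intro mult_right_mono) auto
      also have "\<dots> = D * (1 / R) ^ n * sqrt (2 ^ n)"
        unfolding K1 D_def by simp
      \<comment> \<open>The sqrt(2^n) left over from the normalisation is relaxed to 2^n so as to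
        merge with R^(-n).\<close>
      also have "\<dots> \<le> D * (1 / R) ^ n * 2 ^ n"
      proof (intro mult_left_mono)
        have "(1::real) \<le> 2 ^ n" by simp
        then have "(2::real) ^ n * 1 \<le> 2 ^ n * 2 ^ n" by (intro mult_left_mono) auto
        then show "sqrt (2 ^ n) \<le> 2 ^ n" by (intro real_le_lsqrt) (auto simp: power2_eq_square)
      qed (use C(1) R(1) in \<open>auto simp: D_def\<close>)
      also have "\<dots> = D * (2 / R) ^ n" by (simp add: power_divide)
      finally show ?thesis .
    qed
    show "summable (\<lambda>n. (cmod (f n))\<^sup>2 * 2 ^ (n * p))"
    proof (rule summable_comparison_test')
      show "summable (\<lambda>n. D\<^sup>2 * (1 / 2 :: real) ^ n)" by (intro summable_mult summable_geometric) auto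
      fix n :: nat
      have "(cmod (f n))\<^sup>2 * 2 ^ (n * p) \<le> (D * (2 / R) ^ n)\<^sup>2 * 2 ^ (n * p)"
        by (intro mult_right_mono power_mono fn) auto
      also have "\<dots> = D\<^sup>2 * (((2 / R)\<^sup>2) ^ n * (2 ^ p) ^ n)"
      proof -
        have "((2 / R) ^ n)\<^sup>2 = ((2 / R)\<^sup>2) ^ n" by (simp only: mult.commute flip: power_mult)
        moreover have "(2::real) ^ (n * p) = (2 ^ p) ^ n" by (simp only: mult.commute flip: power_mult)
        ultimately show ?thesis by (simp only: power_mult_distrib[of D] mult.assoc)
      qed
      also have "((2 / R)\<^sup>2) ^ n * (2 ^ p) ^ n = (4 * 2 ^ p / R\<^sup>2) ^ n"
        unfolding power_mult_distrib[symmetric] by (simp add: power_divide)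
      also have "\<dots> \<le> (1 / 2) ^ n" using R by (intro power_mono) auto
      finally show "norm ((cmod (f n))\<^sup>2 * 2 ^ (n * p)) \<le> D\<^sup>2 * (1 / 2) ^ n"
        by (simp add: mult_left_mono)
    qed
  qed
  moreover have "(\<lambda>n. f n * hermite_xi n z) sums (exp (- z\<^sup>2 / 2) * g z)" for z
  proof -
    define B :: real where "B = exp (1 + 1 / 1)"
    have B: "B > 0" by (simp add: B_def)
    \<comment> \<open>This keeps both ratios B/R and 1/R^2 of the double geometric majorant below
      1.\<close>
    define R where "R = max 2 (2 * B)"
    have R: "R > 0" "R \<ge> 2" "R \<ge> 2 * B" by (auto simp: R_def)
    obtain C where C: "C \<ge> 0" "\<And>n m. cmod (c n m) * sqrt (fact n) \<le> C * ((1 / R) ^ n * (1 / R\<^sup>2) ^ m)"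
      using c_bound[OF R(1)] by auto
    let ?E = "exp (1 * (cmod z)\<^sup>2)"
    \<comment> \<open>Along n + 2m = k the factor a_k k!/2^k of \<open>c\<close> is constant, and
      what remains is the expansion of (2z)^k/k!.\<close>
    have diag: "(\<Sum>m | 2 * m \<le> k. c (k - 2 * m) m * hermite_h (k - 2 * m) z) = a k * z ^ k" for k
    proof -
      have "(\<Sum>m | 2 * m \<le> k. c (k - 2 * m) m * hermite_h (k - 2 * m) z)
          = (\<Sum>m | 2 * m \<le> k. (a k * fact k / 2 ^ k) * (hermite_h (k - 2 * m) z / (fact (k - 2 * m) * fact m)))"
        by (rule sum.cong) (auto simp: c_def)
      also have "\<dots> = (a k * fact k / 2 ^ k) * ((2 * z) ^ k / fact k)"
        unfolding power_eq_hermite_sum by (simp only: sum_distrib_left)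
      also have "\<dots> = a k * z ^ k" by (simp add: power_mult_distrib)
      finally show ?thesis .
    qed
    have "(\<lambda>n. \<Sum>m. c n m * hermite_h n z) sums g z"
    proof (rule sums_diagonal_eq_sums_iterated)
      show "0 \<le> B / R" "B / R < 1" "0 \<le> 1 / R\<^sup>2" "1 / R\<^sup>2 < 1"
        using B R power_mono[of 2 R 2] by (auto simp: field_simps)
      show "(\<lambda>k. \<Sum>m | 2 * m \<le> k. c (k - 2 * m) m * hermite_h (k - 2 * m) z) sums g z"
        unfolding diag by (rule g)
      fix n m
      have "cmod (c n m * hermite_h n z) \<le> cmod (c n m) * (sqrt (fact n) * B ^ n * ?E)"
        unfolding norm_mult B_def by (intro mult_left_mono norm_hermite_h_le) auto
      also have "\<dots> = (cmod (c n m) * sqrt (fact n)) * (B ^ n * ?E)" by (simp only: mult_ac)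
      also have "\<dots> \<le> (C * ((1 / R) ^ n * (1 / R\<^sup>2) ^ m)) * (B ^ n * ?E)"
        using B by (intro mult_right_mono C) auto
      also have "\<dots> = C * ?E * ((B / R) ^ n * (1 / R\<^sup>2) ^ m)"
        by (simp add: power_divide)
      finally show "cmod (c n m * hermite_h n z) \<le> C * ?E * ((B / R) ^ n * (1 / R\<^sup>2) ^ m)" .
    qed
    then have "(\<lambda>n. exp (- z\<^sup>2 / 2) * (\<Sum>m. c n m * hermite_h n z)) sums (exp (- z\<^sup>2 / 2) * g z)"
      by (rule sums_mult)
    moreover have "exp (- z\<^sup>2 / 2) * (\<Sum>m. c n m * hermite_h n z) = f n * hermite_xi n z" for n
    proof -
      \<comment> \<open>Needed to take h_n(z) out of the infinite sum over m.\<close>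
      have "summable (c n)"
      proof (rule summable_comparison_test')
        show "summable (\<lambda>m. C * (1 / R) ^ n / sqrt (fact n) * (1 / R\<^sup>2) ^ m)"
          using R power_mono[of 2 R 2] by (intro summable_mult summable_geometric) (auto simp: field_simps)
        show "norm (c n m) \<le> C * (1 / R) ^ n / sqrt (fact n) * (1 / R\<^sup>2) ^ m" for m
        proof -
          have "cmod (c n m) \<le> C * ((1 / R) ^ n * (1 / R\<^sup>2) ^ m) / sqrt (fact n)"
            using C(2)[of n m] by (subst pos_le_divide_eq) simp_all
          then show ?thesis by (simp only: mult.assoc times_divide_eq_left)
        qed
      qed
      then have "(\<Sum>m. c n m * hermite_h n z) = (\<Sum>m. c n m) * hermite_h n z"
        by (rule suminf_mult2[symmetric])
      moreover have "hermite_xi n z = of_real (K n) * exp (- z\<^sup>2 / 2) * hermite_h n z"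
        by (simp only: hermite_xi_def K_def)
      ultimately show ?thesis
        using K[of n] by (simp add: f_def)
    qed
    ultimately show ?thesis by simp
  qed
  ultimately show ?thesis by blast
qed

subsection \<open>The weights\<close>

text \<open>Splitting off x^2 - y^2 leaves the coefficients -2q/(1+q) and -2q/(1-q), whose absolute
  values lie between q and 4q because 0 < q \<le> 1/2.\<close>

lemma weight_exponent_bounds:
  fixes q x y :: real
  assumes q: "0 < q" "q \<le> 1 / 2"
  defines "A \<equiv> (1 - q) / (1 + q) * x\<^sup>2 - (1 + q) / (1 - q) * y\<^sup>2"
  shows "A \<le> x\<^sup>2 - y\<^sup>2 - q * (x\<^sup>2 + y\<^sup>2)" and "x\<^sup>2 - y\<^sup>2 - 4 * q * (x\<^sup>2 + y\<^sup>2) \<le> A"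
proof -
  have A: "A = x\<^sup>2 - y\<^sup>2 - (2 * q / (1 + q) * x\<^sup>2 + 2 * q / (1 - q) * y\<^sup>2)"
    unfolding A_def using q by (simp add: divide_simps) (simp add: algebra_simps)
  have c: "q \<le> 2 * q / (1 + q)" "q \<le> 2 * q / (1 - q)" "2 * q / (1 + q) \<le> 4 * q" "2 * q / (1 - q) \<le> 4 * q"
    using q by (auto simp: field_simps)
  show "A \<le> x\<^sup>2 - y\<^sup>2 - q * (x\<^sup>2 + y\<^sup>2)"
    unfolding A using add_mono[OF mult_right_mono[OF c(1), of "x\<^sup>2"] mult_right_mono[OF c(2), of "y\<^sup>2"]]
    by (simp add: distrib_left)
  show "x\<^sup>2 - y\<^sup>2 - 4 * q * (x\<^sup>2 + y\<^sup>2) \<le> A"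
    unfolding A using add_mono[OF mult_right_mono[OF c(3), of "x\<^sup>2"] mult_right_mono[OF c(4), of "y\<^sup>2"]]
    by (simp add: distrib_left)
qed

lemma norm_exp_half_square: "(cmod (exp (z\<^sup>2 / 2)))\<^sup>2 = exp ((Re z)\<^sup>2 - (Im z)\<^sup>2)"
  and norm_exp_minus_half_square: "(cmod (exp (- z\<^sup>2 / 2)))\<^sup>2 = exp (- ((Re z)\<^sup>2 - (Im z)\<^sup>2))"
  by (simp_all add: Re_power2 diff_divide_distrib flip: exp_double)

lemma two_powr_minus_nat_le: "p \<ge> 1 \<Longrightarrow> 2 powr (- real p) \<le> 1 / 2"
  using powr_mono[of "- real p" "-1" 2] by (simp add: powr_minus)

section \<open>The two inclusions between Hermite series and weighted square integrable entire
  functions\<close>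

theorem theorem6p3:
  "space_G =
     {F. F holomorphic_on UNIV \<and>
         (\<forall>p::nat. p \<ge> 1 \<longrightarrow>
            (\<integral>\<^sup>+ z. ennreal ((cmod (F z))\<^sup>2 *
                 exp ((1 - 2 powr (- real p)) / (1 + 2 powr (- real p)) * (Re z)\<^sup>2
                    - (1 + 2 powr (- real p)) / (1 - 2 powr (- real p)) * (Im z)\<^sup>2))
              \<partial>lborel) < \<infinity>)}"
proof (intro equalityI subsetI CollectI conjI allI impI; (elim CollectE conjE)?)
  fix F assume "F \<in> space_G"
  then obtain f where f: "f \<in> rapid_coeffs" and F: "F = (\<lambda>z. \<Sum>n. f n * hermite_xi n z)"
    by (auto simp: space_G_def)
  show "F holomorphic_on UNIV"
    unfolding F by (rule hermite_series_entire[OF f])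
  fix p :: nat assume p: "p \<ge> 1"
  define q :: real where "q = 2 powr (- real p)"
  have q: "0 < q" "q \<le> 1 / 2" using two_powr_minus_nat_le[OF p] by (auto simp: q_def)
  \<comment> \<open>Squaring the growth bound with q/4 costs exp(q/2 |z|^2), while the weight gains
    exp(- q |z|^2); a Gaussian with exponent -q/2 |z|^2 remains.\<close>
  obtain C where C: "C \<ge> 0" "\<And>z. cmod (F z) \<le> C * (exp (q / 4 * (cmod z)\<^sup>2) * cmod (exp (- z\<^sup>2 / 2)))"
    unfolding F using hermite_series_growth[OF f, of "q / 4"] q by auto
  have "(\<integral>\<^sup>+ z. ennreal ((cmod (F z))\<^sup>2 * exp ((1 - q) / (1 + q) * (Re z)\<^sup>2 - (1 + q) / (1 - q) * (Im z)\<^sup>2)) \<partial>lborel)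
      \<le> (\<integral>\<^sup>+ z. ennreal (C\<^sup>2) * ennreal (exp (- (q / 2) * (cmod z)\<^sup>2)) \<partial>lborel)"
  proof (rule nn_integral_mono)
    fix z
    let ?A = "(1 - q) / (1 + q) * (Re z)\<^sup>2 - (1 + q) / (1 - q) * (Im z)\<^sup>2"
    have "(cmod (F z))\<^sup>2 \<le> (C * (exp (q / 4 * (cmod z)\<^sup>2) * cmod (exp (- z\<^sup>2 / 2))))\<^sup>2"
      by (intro power_mono C) auto
    also have "\<dots> = C\<^sup>2 * exp (q / 2 * (cmod z)\<^sup>2 - ((Re z)\<^sup>2 - (Im z)\<^sup>2))"
      unfolding power_mult_distrib norm_exp_minus_half_square
      by (simp add: algebra_simps flip: exp_double exp_add)
    finally have "(cmod (F z))\<^sup>2 * exp ?A \<le> C\<^sup>2 * exp (q / 2 * (cmod z)\<^sup>2 - ((Re z)\<^sup>2 - (Im z)\<^sup>2)) * exp ?A"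
      by (rule mult_right_mono) simp
    also have "\<dots> = C\<^sup>2 * exp (q / 2 * (cmod z)\<^sup>2 - ((Re z)\<^sup>2 - (Im z)\<^sup>2) + ?A)"
      by (simp only: exp_add mult.assoc)
    also have "\<dots> \<le> C\<^sup>2 * exp (- (q / 2) * (cmod z)\<^sup>2)"
      using weight_exponent_bounds(1)[OF q, of "Re z" "Im z"]
      by (intro mult_left_mono) (auto simp: cmod_power2 algebra_simps)
    finally show "ennreal ((cmod (F z))\<^sup>2 * exp ?A) \<le> ennreal (C\<^sup>2) * ennreal (exp (- (q / 2) * (cmod z)\<^sup>2))"
      by (simp flip: ennreal_mult)
  qed
  also have "\<dots> < \<infinity>"
    using nn_integral_gauss_complex[of "q / 2"] q by (subst nn_integral_cmult) (auto simp: ennreal_mult_less_top)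
  finally show "(\<integral>\<^sup>+ z. ennreal ((cmod (F z))\<^sup>2 *
                 exp ((1 - 2 powr (- real p)) / (1 + 2 powr (- real p)) * (Re z)\<^sup>2
                    - (1 + 2 powr (- real p)) / (1 - 2 powr (- real p)) * (Im z)\<^sup>2))
              \<partial>lborel) < \<infinity>"
    unfolding q_def .
next
  fix F :: "complex \<Rightarrow> complex"
  assume F: "F holomorphic_on UNIV"
    and I: "\<forall>p::nat. p \<ge> 1 \<longrightarrow>
            (\<integral>\<^sup>+ z. ennreal ((cmod (F z))\<^sup>2 *
                 exp ((1 - 2 powr (- real p)) / (1 + 2 powr (- real p)) * (Re z)\<^sup>2
                    - (1 + 2 powr (- real p)) / (1 - 2 powr (- real p)) * (Im z)\<^sup>2))
              \<partial>lborel) < \<infinity>"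
  \<comment> \<open>The Gaussian factor common to all \<open>hermite_xi\<close> is removed; |g|^2 is
    |F|^2 exp(x^2 - y^2), the leading part of every weight.\<close>
  define g where "g z = exp (z\<^sup>2 / 2) * F z" for z
  have g: "g holomorphic_on UNIV" unfolding g_def by (intro holomorphic_intros F) auto
  have gI: "(\<integral>\<^sup>+z. ennreal ((cmod (g z))\<^sup>2 * exp (- \<epsilon> * (cmod z)\<^sup>2)) \<partial>lborel) < \<infinity>" if e: "\<epsilon> > 0" for \<epsilon>
  proof -
    \<comment> \<open>A large p makes 4q \<le> \<epsilon>, so the weight with this p dominates the
      Gaussian with parameter \<epsilon>; the successor ensures p \<ge> 1.\<close>
    obtain p0 :: nat where p0: "4 / \<epsilon> < 2 ^ p0" using real_arch_pow[of 2 "4 / \<epsilon>"] by auto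
    define p where "p = Suc p0"
    define q :: real where "q = 2 powr (- real p)"
    have q: "0 < q" "q \<le> 1 / 2" using two_powr_minus_nat_le[of p] by (auto simp: q_def p_def)
    have qe: "4 * q \<le> \<epsilon>"
    proof -
      have "4 / \<epsilon> \<le> 2 ^ p"
        by (rule order_trans[OF less_imp_le[OF p0]], rule power_increasing) (auto simp: p_def)
      moreover have "q = 1 / 2 ^ p" by (simp add: q_def powr_minus powr_realpow divide_inverse)
      ultimately show ?thesis using e by (simp only:) (simp add: field_simps)
    qed
    have "(\<integral>\<^sup>+z. ennreal ((cmod (g z))\<^sup>2 * exp (- \<epsilon> * (cmod z)\<^sup>2)) \<partial>lborel)
        \<le> (\<integral>\<^sup>+z. ennreal ((cmod (F z))\<^sup>2 * exp ((1 - q) / (1 + q) * (Re z)\<^sup>2 - (1 + q) / (1 - q) * (Im z)\<^sup>2)) \<partial>lborel)"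
    proof (rule nn_integral_mono)
      fix z
      let ?A = "(1 - q) / (1 + q) * (Re z)\<^sup>2 - (1 + q) / (1 - q) * (Im z)\<^sup>2"
      have "4 * q * (cmod z)\<^sup>2 \<le> \<epsilon> * (cmod z)\<^sup>2" using qe by (rule mult_right_mono) simp
      then have "(Re z)\<^sup>2 - (Im z)\<^sup>2 + - \<epsilon> * (cmod z)\<^sup>2 \<le> ?A"
        using weight_exponent_bounds(2)[OF q, of "Re z" "Im z"] by (simp add: cmod_power2)
      then have "(cmod (F z))\<^sup>2 * exp ((Re z)\<^sup>2 - (Im z)\<^sup>2 + - \<epsilon> * (cmod z)\<^sup>2) \<le> (cmod (F z))\<^sup>2 * exp ?A"
        by (intro mult_left_mono) auto
      moreover have "(cmod (g z))\<^sup>2 * exp (- \<epsilon> * (cmod z)\<^sup>2)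
          = (cmod (F z))\<^sup>2 * exp ((Re z)\<^sup>2 - (Im z)\<^sup>2 + - \<epsilon> * (cmod z)\<^sup>2)"
        unfolding g_def norm_mult power_mult_distrib norm_exp_half_square exp_add by (simp only: mult_ac)
      ultimately show "ennreal ((cmod (g z))\<^sup>2 * exp (- \<epsilon> * (cmod z)\<^sup>2)) \<le> ennreal ((cmod (F z))\<^sup>2 * exp ?A)"
        by (simp add: ennreal_leI)
    qed
    also have "\<dots> < \<infinity>" using I[rule_format, of p] by (simp add: q_def p_def)
    finally show ?thesis .
  qed
  have "\<exists>f\<in>rapid_coeffs. \<forall>z. (\<lambda>n. f n * hermite_xi n z) sums (exp (- z\<^sup>2 / 2) * g z)"
  proof (rule hermite_expansion_of_power_series)
    show "\<exists>C\<ge>0. \<forall>k. cmod ((deriv ^^ k) g 0 / fact k) * sqrt (fact k) * R ^ k \<le> C" if "R > 0" for R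
      by (rule taylor_coeff_bound_of_gauss_integrable[OF g gI that])
    show "(\<lambda>k. (deriv ^^ k) g 0 / fact k * z ^ k) sums g z" for z
      \<comment> \<open>Since g is entire, the disc about 0 may be taken just large enough to
        contain z.\<close>
      using holomorphic_power_series[of g 0 "cmod z + 1" z] g holomorphic_on_subset by fastforce
  qed
  then obtain f where f: "f \<in> rapid_coeffs"
    and s: "\<And>z. (\<lambda>n. f n * hermite_xi n z) sums (exp (- z\<^sup>2 / 2) * g z)" by blast
  have "exp (- z\<^sup>2 / 2) * g z = F z" for z
  proof -
    have "exp (- z\<^sup>2 / 2) * exp (z\<^sup>2 / 2) = 1" by (simp flip: exp_add)
    then show ?thesis unfolding g_def by (simp add: mult.assoc[symmetric])
  qed
  with s have "F = (\<lambda>z. \<Sum>n. f n * hermite_xi n z)" by (auto simp: fun_eq_iff sums_iff)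
  with f show "F \<in> space_G" by (auto simp: space_G_def)
qed

end
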